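(* Let $d\ge2$ and $\alpha\in(d-2,d)$. Suppose $F\Subset\square_0=(-\frac12,\frac12)^d$ is a compact $\alpha$-Ahlfors regular set: there exist a Borel probability measure $\mu_F$ supported on $F$ and a constant $C_0\ge1$ with $$C_0^{-1}r^\alpha\le\mu_F(B(x,r))\le C_0r^\alpha\qquad\text{for all }x\in F,\ r\in(0,1).$$ Let $\eta\in C_c^\infty(\mathbb R^d)$ be a standard nonnegative mollifier with $\int\eta=1$ and $\operatorname{supp}\eta\subseteq B_1(0)$, put $\eta_\delta(x)=\delta^{-d}\eta(x/\delta)$ for $\delta\in(0,1)$, and define $\mu_F^\delta(x)=\int_{\square_0}\eta_\delta(x-y)\,d\mu_F(y)$ for $x\in\square_0$, and $a_\delta=1+\mu_F^\delta$. Then: (i) For every $\delta\in(0,\delta_0)$, with $\delta_0:=\min\{1,\operatorname{dist}(F,\partial\square_0)\}/(4d)$, $a_\delta\in L^1(\square_0)$ and $\int_{\square_0}a_\delta=1+\mu_F(\square_0)=2$. (ii) For every $p>1$, $\lim_{\delta\to0}\|\mu_F^\delta\|_{L^p(\square_0)}=\infty$. (iii) If $s\in(0,1)$ satisfies $2s>d-\alpha$, then there is a constant $C=C(d,\alpha,C_0,s,\eta)<\infty$ such that, for every admissible cone $\mathcal K$, the quantity $\Lambda_s(\square_0;\mathcal K)$ of the coefficient field $a_\delta\mathrm I_d$ satisfies $$\sup_{\delta\in(0,1)}\Lambda_s(\square_0;\mathcal K)\le C .$$ In particular, the family $(a_\delta)_{\delta\in(0,1)}$ is coarse-grained elliptic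 for all $s\in(\frac{d-\alpha}2,1)$ with constants independent of $\delta$, while the $L^p$ norms of $a_\delta$ diverge as $\delta\to0$ for every $p>1$.
   Context: Notation: $\square_m=(-\frac12 3^m,\frac12 3^m)^d$ for $m\in\mathbb Z$; $\fint_U$ is the average over $U$; $\mathfrak c_s=1-3^{-s}$. For a field $\mathbf a$ of symmetric positive semi-definite matrices, invertible a.e., with $\mathbf a,\mathbf a^{-1}\in L^1(U)$, $H^1_{\mathbf a}(U)$ is the completion of $C^\infty(\overline U)$ in the norm $(\|u\|_{L^2(U)}^2+\int_U\nabla u\cdot\mathbf a\nabla u)^{1/2}$. The admissible cones $\mathcal K(U)\subseteq H^1_{\mathbf a}(U)$ are the following families and their unions, where $\mathcal A(U)$ denotes the weak solutions $u\in H^1_{\mathbf a}(U)$ of $\nabla\cdot\mathbf a\nabla u=0$ in $U$ (tested against $C_c^\infty(U)$): (1) $\mathcal A(U)$; (2) the weak subsolutions ($\int_U\nabla\psi\cdot\mathbf a\nabla u\le0$ for all $0\le\psi\in C_c^\infty(U)$); (3) $\{\Phi(u)\in H^1_{\mathbf a}(U):u\in\mathcal A(U),\ \Phi:u(U)\to\mathbb R\ C^1\text{, convex, monotone}\}$; (4) $\mathcal K_{\mathrm{trunc}}(U)=\{(u-k)_+:u\in\mathcal A(U),k\in\mathbb R\}$; (5) $\mathcal K_{\mathrm{pow}}(U)=\{\Phi(u)\in H^1_{\mathbf a}(U):u\in\mathcal A(U),u\ge0,\ \Phi'(u)=Cu^r,\ C,r\in\mathbb R,\ \Phi\text{ convex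 and monotone on }u(U)\}$; (6) $H^1_{\mathbf a}(U)$. $\mathbf a(U,p;\mathcal K)=\sup_{u\in\mathcal K(U)}\fint_U(-\nabla u\cdot\mathbf a\nabla u+2p\cdot\mathbf a\nabla u)$, $\|\mathbf a(U;\mathcal K)\|=\sup_{|p|=1}\mathbf a(U,p;\mathcal K)$; the matrix $\mathbf a_*^{-1}(U)$ is defined by $q\cdot\mathbf a_*^{-1}(U)q=\sup_{u\in\mathcal A(U)}\fint_U(-\nabla u\cdot\mathbf a\nabla u+2q\cdot\nabla u)$; $$\Lambda_s(\square_m;\mathcal K)=\Bigl(\mathfrak c_s\sum_{k=-\infty}^m3^{-s(m-k)}\max_{z\in3^k\mathbb Z^d\cap\square_m}\|\mathbf a(z+\square_k;\mathcal K)\|^{1/2}\Bigr)^2,$$ $$\lambda_s(\square_m)=\Bigl(\mathfrak c_s\sum_{k=-\infty}^m3^{-s(m-k)}\max_{z\in3^k\mathbb Z^d\cap\square_m}|\mathbf a_*^{-1}(z+\square_k)|^{1/2}\Bigr)^{-2},$$ $\Theta_{s,t}=\Lambda_s/\lambda_t$. $\mathbf a$ is coarse-grained elliptic in $\square_0$ if $\Theta_{s,t}(\square_0;\mathcal K_{\mathrm{pow}}\cup\mathcal K_{\mathrm{trunc}})<\infty$ for some $s,t\in(0,1)$ with $s+t<1$; "coarse-grained elliptic for $s$ with constants independent of $\delta$" means that $\Theta_{s,t}$ is bounded uniformly in $\delta$ for $t\in(0,1-s)$. *)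

theory Defs
  imports "HOL-Analysis.Analysis" "HOL-Probability.Probability_Measure"
begin

section \<open>Smooth functions and triadic cubes\<close>

primrec C_k :: "nat \<Rightarrow> ('a::real_normed_vector \<Rightarrow> real) \<Rightarrow> bool" where
  "C_k 0 f \<longleftrightarrow> continuous_on UNIV f"
| "C_k (Suc k) f \<longleftrightarrow> f differentiable_on UNIV \<and> (\<forall>v. C_k k (\<lambda>x. frechet_derivative f (at x) v))"

definition C_infinity :: "('a::real_normed_vector \<Rightarrow> real) \<Rightarrow> bool" where
  "C_infinity f \<longleftrightarrow> (\<forall>k. C_k k f)"

definition supp :: "('a::topological_space \<Rightarrow> real) \<Rightarrow> 'a set" where
  "supp f = closure {x. f x \<noteq> 0}"

definition C_c_infinity :: "'a::real_normed_vector set \<Rightarrow> ('a \<Rightarrow> real) set" where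
  "C_c_infinity U = {\<psi>. C_infinity \<psi> \<and> compact (supp \<psi>) \<and> supp \<psi> \<subseteq> U}"

definition grad :: "(real^'n \<Rightarrow> real) \<Rightarrow> real^'n \<Rightarrow> real^'n" where
  "grad f x = (\<chi> i. frechet_derivative f (at x) (axis i 1))"

definition cube :: "int \<Rightarrow> (real^'n) set" where
  "cube m = box (\<chi> i. - (3 powi m / 2)) (\<chi> i. 3 powi m / 2)"

definition subcube :: "real^'n \<Rightarrow> int \<Rightarrow> (real^'n) set" where
  "subcube z k = (\<lambda>x. z + x) ` cube k"

definition lattice :: "int \<Rightarrow> (real^'n) set" where
  "lattice k = {z. \<forall>i. \<exists>j::int. z $ i = 3 powi k * of_int j}"

definition avg :: "(real^'n) set \<Rightarrow> (real^'n \<Rightarrow> real) \<Rightarrow> real" where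
  "avg U f = (\<integral>x. f x \<partial>lebesgue_on U) / measure lebesgue U"


section \<open>The weighted Sobolev space and the admissible cones\<close>

text \<open>
  A coefficient field \<open>a\<close> is meant to take symmetric positive semi-definite values, to be invertible
  almost everywhere, and to satisfy \<open>a\<close>, \<open>a\<^sup>-\<^sup>1\<close> \<open>\<in> L\<^sup>1(U)\<close>. Then Cauchy sequences of smooth functions
  converge, together with their gradients, in \<open>L\<^sup>1(U)\<close>, and the limiting gradient is determined by the
  limit function. The completion is therefore realised concretely as a set of pairs \<open>(u, g)\<close> of a
  function and its gradient, where all representatives of the almost-everywhere class are included.
  The sets \<open>U\<close> used below are cubes, for which the functions smooth up to the boundary are the
  restrictions of smooth functions on the whole space.
\<close>

type_synonym 'n field = "real^'n \<Rightarrow> real^'n^'n"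
type_synonym 'n fun_grad = "(real^'n \<Rightarrow> real) \<times> (real^'n \<Rightarrow> real^'n)"
type_synonym 'n cone = "'n field \<Rightarrow> (real^'n) set \<Rightarrow> 'n fun_grad set"

definition H1 :: "'n::finite cone" where
  "H1 a U = {(u, g). u \<in> borel_measurable (lebesgue_on U) \<and> g \<in> borel_measurable (lebesgue_on U) \<and>
     (\<exists>\<phi>. (\<forall>n::nat. C_infinity (\<phi> n)) \<and>
        (\<lambda>n. \<integral>\<^sup>+x. ennreal ((\<phi> n x - u x)\<^sup>2
               + (grad (\<phi> n) x - g x) \<bullet> (a x *v (grad (\<phi> n) x - g x))) \<partial>lebesgue_on U)
        \<longlonglongrightarrow> 0)}"

definition solutions :: "'n::finite cone" where
  "solutions a U = {(u, g) \<in> H1 a U.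
     \<forall>\<psi> \<in> C_c_infinity U. (\<integral>x. grad \<psi> x \<bullet> (a x *v g x) \<partial>lebesgue_on U) = 0}"

definition subsolutions :: "'n::finite cone" where
  "subsolutions a U = {(u, g) \<in> H1 a U.
     \<forall>\<psi> \<in> C_c_infinity U. (\<forall>x. 0 \<le> \<psi> x) \<longrightarrow> (\<integral>x. grad \<psi> x \<bullet> (a x *v g x) \<partial>lebesgue_on U) \<le> 0}"

definition monotone_fun_on :: "real set \<Rightarrow> (real \<Rightarrow> real) \<Rightarrow> bool" where
  "monotone_fun_on J \<Phi> \<longleftrightarrow> mono_on J \<Phi> \<or> antimono_on J \<Phi>"

definition C1_on :: "real set \<Rightarrow> (real \<Rightarrow> real) \<Rightarrow> bool" where
  "C1_on J \<Phi> \<longleftrightarrow> (\<exists>\<Phi>'. (\<forall>t\<in>J. (\<Phi> has_real_derivative \<Phi>' t) (at t within J)) \<and> continuous_on J \<Phi>')"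

text \<open>
  The range \<open>u(U)\<close> is read as the interval spanned by the values of a representative of \<open>u\<close>. For
  connected \<open>U\<close> and the continuous representative this is \<open>u(U)\<close> itself.
\<close>

definition range_hull :: "(real^'n \<Rightarrow> real) \<Rightarrow> (real^'n) set \<Rightarrow> real set" where
  "range_hull u U = convex hull (u ` U)"

definition K_convex :: "'n::finite cone" where
  "K_convex a U = {(v, h) \<in> H1 a U. \<exists>u g \<Phi>. (u, g) \<in> solutions a U \<and>
     C1_on (range_hull u U) \<Phi> \<and> convex_on (range_hull u U) \<Phi> \<and> monotone_fun_on (range_hull u U) \<Phi> \<and>
     (AE x in lebesgue_on U. v x = \<Phi> (u x))}"

definition K_trunc :: "'n::finite cone" where
  "K_trunc a U = {(v, h) \<in> H1 a U. \<exists>u g k. (u, g) \<in> solutions a U \<and>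
     (AE x in lebesgue_on U. v x = max (u x - k) 0)}"

text \<open>
  The identity \<open>\<Phi>'(t) = C t\<^sup>r\<close> is imposed at positive \<open>t\<close> only, with \<open>\<Phi>\<close> continuous up to \<open>t = 0\<close>:
  the power is singular at \<open>0\<close> for negative \<open>r\<close>, and \<open>0 powr 0 = 0\<close> would be wrong for \<open>r = 0\<close>.
\<close>

definition K_pow :: "'n::finite cone" where
  "K_pow a U = {(v, h) \<in> H1 a U. \<exists>u g \<Phi> C r. (u, g) \<in> solutions a U \<and> (\<forall>x\<in>U. 0 \<le> u x) \<and>
     continuous_on (range_hull u U) \<Phi> \<and>
     (\<forall>t\<in>range_hull u U. 0 < t \<longrightarrow> (\<Phi> has_real_derivative C * t powr r) (at t within range_hull u U)) \<and>
     convex_on (range_hull u U) \<Phi> \<and> monotone_fun_on (range_hull u U) \<Phi> \<and>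
     (AE x in lebesgue_on U. v x = \<Phi> (u x))}"

definition cone_Un :: "'n::finite cone set \<Rightarrow> 'n cone" where
  "cone_Un S a U = (\<Union>K\<in>S. K a U)"

definition admissible_cone :: "'n::finite cone \<Rightarrow> bool" where
  "admissible_cone K \<longleftrightarrow>
     (\<exists>S \<subseteq> {solutions, subsolutions, K_convex, K_trunc, K_pow, H1}. S \<noteq> {} \<and> K = cone_Un S)"


section \<open>Coarse-grained coefficients and ellipticity\<close>

definition cg_coeff :: "'n::finite cone \<Rightarrow> 'n field \<Rightarrow> (real^'n) set \<Rightarrow> real^'n \<Rightarrow> ereal" where
  "cg_coeff K a U p =
     (SUP (u, g) \<in> K a U. ereal (avg U (\<lambda>x. - (g x \<bullet> (a x *v g x)) + 2 * (p \<bullet> (a x *v g x)))))"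

definition cg_norm :: "'n::finite cone \<Rightarrow> 'n field \<Rightarrow> (real^'n) set \<Rightarrow> ereal" where
  "cg_norm K a U = (SUP p \<in> sphere 0 1. cg_coeff K a U p)"

definition a_star_inv :: "'n::finite field \<Rightarrow> (real^'n) set \<Rightarrow> real^'n^'n" where
  "a_star_inv a U = (THE M. transpose M = M \<and>
     (\<forall>q. ereal (q \<bullet> (M *v q)) =
        (SUP (u, g) \<in> solutions a U. ereal (avg U (\<lambda>x. - (g x \<bullet> (a x *v g x)) + 2 * (q \<bullet> g x))))))"

definition ennsqrt :: "ennreal \<Rightarrow> ennreal" where
  "ennsqrt x = (if x = \<infinity> then \<infinity> else ennreal (sqrt (enn2real x)))"

definition c_s :: "real \<Rightarrow> real" where
  "c_s s = 1 - 3 powr (- s)"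

text \<open>
  All admissible cones contain the zero function, so \<open>cg_norm\<close> is nonnegative and the conversion
  \<open>e2ennreal\<close> loses nothing. For \<open>k \<le> m\<close> the suprema over \<open>z\<close> range over finite nonempty sets, i.e.,
  they are maxima.
\<close>

definition Lambda_s :: "real \<Rightarrow> int \<Rightarrow> 'n::finite cone \<Rightarrow> 'n field \<Rightarrow> ennreal" where
  "Lambda_s s m K a =
     (ennreal (c_s s) * (\<Sum>\<^sub>\<infinity>k\<in>{..m}. ennreal (3 powr (- s * of_int (m - k))) *
        (SUP z \<in> lattice k \<inter> cube m. ennsqrt (e2ennreal (cg_norm K a (subcube z k))))))\<^sup>2"

definition lambda_s :: "real \<Rightarrow> int \<Rightarrow> 'n::finite field \<Rightarrow> ennreal" where
  "lambda_s s m a = inverse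
     ((ennreal (c_s s) * (\<Sum>\<^sub>\<infinity>k\<in>{..m}. ennreal (3 powr (- s * of_int (m - k))) *
        (SUP z \<in> lattice k \<inter> cube m. ennreal (sqrt (onorm ((*v) (a_star_inv a (subcube z k))))))))\<^sup>2)"

definition Theta_s_t :: "real \<Rightarrow> real \<Rightarrow> int \<Rightarrow> 'n::finite cone \<Rightarrow> 'n field \<Rightarrow> ennreal" where
  "Theta_s_t s t m K a = Lambda_s s m K a / lambda_s t m a"

definition uniformly_cg_elliptic :: "real \<Rightarrow> 'i set \<Rightarrow> ('i \<Rightarrow> 'n::finite field) \<Rightarrow> bool" where
  "uniformly_cg_elliptic s I a \<longleftrightarrow>
     (\<exists>C::real. \<forall>t\<in>{0<..<1 - s}. \<forall>i\<in>I. Theta_s_t s t 0 (cone_Un {K_pow, K_trunc}) (a i) \<le> ennreal C)"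


section \<open>Ahlfors regular sets and mollified measures\<close>

definition ahlfors_regular :: "real \<Rightarrow> real \<Rightarrow> (real^'n) set \<Rightarrow> (real^'n) measure \<Rightarrow> bool" where
  "ahlfors_regular \<alpha> C\<^sub>0 F \<mu> \<longleftrightarrow> sets \<mu> = sets borel \<and> prob_space \<mu> \<and> measure \<mu> F = 1 \<and>
     (\<forall>x\<in>F. \<forall>r\<in>{0<..<1}. r powr \<alpha> / C\<^sub>0 \<le> measure \<mu> (ball x r) \<and> measure \<mu> (ball x r) \<le> C\<^sub>0 * r powr \<alpha>)"

text \<open>The closed unit ball also allows for the usual bump function \<open>c exp (-1/(1 - |x|\<^sup>2))\<close>.\<close>

definition mollifier :: "(real^'n \<Rightarrow> real) \<Rightarrow> bool" where
  "mollifier \<eta> \<longleftrightarrow> C_infinity \<eta> \<and> supp \<eta> \<subseteq> cball 0 1 \<and> (\<forall>x. 0 \<le> \<eta> x) \<and> (\<integral>x. \<eta> x \<partial>lebesgue) = 1"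

definition mollified_measure ::
    "(real^'n \<Rightarrow> real) \<Rightarrow> (real^'n) measure \<Rightarrow> real \<Rightarrow> real^'n \<Rightarrow> real" where
  "mollified_measure \<eta> \<mu> \<delta> x = (LINT y:cube 0|\<mu>. \<eta> ((x - y) /\<^sub>R \<delta>) / \<delta> ^ CARD('n))"

definition a_delta :: "(real^'n \<Rightarrow> real) \<Rightarrow> (real^'n) measure \<Rightarrow> real \<Rightarrow> real^'n \<Rightarrow> real" where
  "a_delta \<eta> \<mu> \<delta> x = 1 + mollified_measure \<eta> \<mu> \<delta> x"

text \<open>
  The value is \<open>0\<close> instead of \<open>\<infinity>\<close> if \<open>f\<close> is measurable but not in \<open>L\<^sup>p\<close>; divergence to infinity of this
  quantity therefore implies divergence of the actual norm.
\<close>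

definition Lp_norm :: "real \<Rightarrow> (real^'n) set \<Rightarrow> (real^'n \<Rightarrow> real) \<Rightarrow> real" where
  "Lp_norm p U f = (\<integral>x. \<bar>f x\<bar> powr p \<partial>lebesgue_on U) powr (1 / p)"

end

theory Submission
  imports Defs
begin

text \<open>
  Completing the square gives \<open>\<parallel>a(U; K)\<parallel> \<le> avg U a\<close> for every cone \<open>K\<close>, so \<open>\<Lambda>\<^sub>s\<close> is controlled by the averages
  of \<open>1 + \<mu>\<^sup>\<delta>\<close> over triadic cubes of size \<open>3\<^sup>k\<close>. By Ahlfors regularity these are at most
  \<open>C 3\<^bsup>k(\<alpha>-d)\<^esup>\<close> uniformly in \<open>\<delta>\<close>, and the resulting series with terms \<open>3\<^bsup>k(s-(d-\<alpha>)/2)\<^esup>\<close>, \<open>k \<le> 0\<close>,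
  converges precisely because \<open>2s > d - \<alpha>\<close>. Since \<open>a \<ge> 1\<close>, the dual coefficients satisfy \<open>|a\<^sub>*\<^sup>-\<^sup>1| \<le> 1\<close>;
  that the supremum defining \<open>a\<^sub>*\<^sup>-\<^sup>1\<close> is the quadratic form of a matrix follows from the parallelogram law
  and the Jordan--von Neumann argument. The mass of \<open>\<mu>\<^sup>\<delta>\<close> is one, while its support, the
  \<open>\<delta>\<close>-neighbourhood of \<open>F\<close>, has measure at most \<open>C \<delta>\<^bsup>d-\<alpha>\<^esup>\<close>; hence the \<open>L\<^sup>p\<close> norms diverge.
\<close>

section \<open>Quadratic forms defined by suprema\<close>

text \<open>For each fixed \<open>\<delta>\<close> the field is bounded, but only by a multiple of
  the power -d of \<open>\<delta>\<close>. That bound serves integrability alone; the constants of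
  the conclusion have to come from the lower bound 1, the mollifier and the masses of balls. They
  are built from d, \<open>\<alpha>\<close>, \<open>C\<^sub>0\<close>, \<open>\<eta>\<close> and s,
  so they are available before F, the measure and the cone are chosen. The matrix argument on the
  dual side is forced by \<open>a_star_inv\<close> being a definite description: nothing can be
  inferred about it before existence and uniqueness of a symmetric matrix with that form are known.
  The factor \<open>c_s t\<close> is the reciprocal of the geometric series with ratio 3^(-t), so a
  dual bound by 1 on every cube makes \<open>lambda_s\<close> at t at least 1 for every t > 0. Hence
  \<open>Theta_s_t\<close> is at most \<open>Lambda_s\<close>, with no loss as t tends to 0. The
  threshold (d - \<alpha>)/2 is half the growth exponent of the averages because
  \<open>Lambda_s\<close> sums square roots.\<close>

lemma jordan_von_neumann_additive:
  fixes Q :: "'a::real_vector \<Rightarrow> real"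
  assumes par: "\<And>x y. Q (x + y) + Q (x - y) = 2 * Q x + 2 * Q y"
  defines "P \<equiv> \<lambda>x y. (Q (x + y) - Q (x - y)) / 4"
  shows "P (x + y) z = P x z + P y z"
proof -
  have even: "Q (- x) = Q x" for x
    using par[of 0 x] par[of 0 0] by simp
  \<comment> \<open>Subtracting the law for \<open>x - z\<close>, \<open>y\<close> from that for
    \<open>x + z\<close>, \<open>y\<close> leaves Jensen's equation. Since P vanishes at 0, it
    doubles at x = y; read at the half sum and half difference it becomes additivity.\<close>
  have jensen: "P (x + y) z + P (x - y) z = 2 * P x z" for x y
  proof -
    have "Q (x + y + z) + Q (x - y + z) = 2 * Q (x + z) + 2 * Q y"
      using par[of "x + z" y] by (simp add: algebra_simps)
    moreover have "Q (x + y - z) + Q (x - y - z) = 2 * Q (x - z) + 2 * Q y"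
      using par[of "x - z" y] by (simp add: algebra_simps)
    ultimately show ?thesis
      unfolding P_def by (simp add: field_simps)
  qed
  have "P 0 z = 0"
    unfolding P_def using even[of z] by simp
  then have double: "P (x + x) z = 2 * P x z" for x
    using jensen[of x x] by simp
  define u v where "u = (1/2) *\<^sub>R (x + y)" and "v = (1/2) *\<^sub>R (x - y)"
  have uv: "u + v = x" "u - v = y" "u + u = x + y"
    unfolding u_def v_def by (simp_all flip: scaleR_add_right scaleR_diff_right scaleR_2 scaleR_left_distrib)
  show ?thesis
    using jensen[of u v] double[of u] unfolding uv by simp
qed

text \<open>Cauchy's functional equation has wild solutions; a bound near 0 excludes them. For a
  polarised supremum such a bound comes directly from the bounds on the quadratic form, without a
  continuity argument.\<close>

lemma additive_bounded_imp_scaleR: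
  fixes f :: "'a::real_normed_vector \<Rightarrow> real"
  assumes add: "\<And>x y. f (x + y) = f x + f y"
    and bnd: "\<And>x. norm x \<le> R \<Longrightarrow> \<bar>f x\<bar> \<le> K" and "0 < R"
  shows "f (t *\<^sub>R x) = t * f x"
proof -
  have f0: "f 0 = 0"
    using add[of 0 0] by simp
  have fneg: "f (- x) = - f x" for x
    using add[of x "- x"] f0 by simp
  have nat: "f (real n *\<^sub>R x) = real n * f x" for n x
    by (induction n) (simp_all add: f0 add algebra_simps)
  have int: "f (of_int k *\<^sub>R x) = of_int k * f x" for k x
    by (cases k rule: int_cases2) (use nat fneg in auto)
  \<comment> \<open>The deviation from linearity is additive and 1-periodic, hence bounded, hence zero.\<close>
  define g where "g t = f (t *\<^sub>R x) - t * f x" for t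
  have g_int: "g (t + of_int k) = g t" for t k
    unfolding g_def by (simp add: scaleR_left_distrib add int algebra_simps)
  have g_nat: "g (real n * t) = real n * g t" for n t
    using nat[of n "t *\<^sub>R x"] unfolding g_def by (simp add: algebra_simps)
  \<comment> \<open>Division by N + 1 brings t x with 0 <= t < 1 into the ball of radius R;
    additivity then costs the factor N + 1.\<close>
  obtain N :: nat where N: "norm x / R \<le> real N"
    using real_arch_simple by blast
  have g_bnd: "\<bar>g t\<bar> \<le> real (Suc N) * K + \<bar>f x\<bar>" if "0 \<le> t" "t < 1" for t
  proof -
    have "norm (inverse (real (Suc N)) *\<^sub>R (t *\<^sub>R x)) \<le> R"
    proof -
      have "norm x \<le> R * real (Suc N)"
        using N \<open>0 < R\<close> by (simp add: pos_divide_le_eq algebra_simps)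
      moreover have "t * norm x \<le> norm x"
        using that by (simp add: mult_left_le_one_le)
      ultimately show ?thesis
        using that by (simp add: field_simps)
    qed
    then have "\<bar>f (inverse (real (Suc N)) *\<^sub>R (t *\<^sub>R x))\<bar> \<le> K"
      by (rule bnd)
    moreover have "f (t *\<^sub>R x) = real (Suc N) * f (inverse (real (Suc N)) *\<^sub>R (t *\<^sub>R x))"
      using nat[of "Suc N" "inverse (real (Suc N)) *\<^sub>R (t *\<^sub>R x)"]
      by (simp del: of_nat_Suc scaleR_scaleR add: scaleR_scaleR[of "real (Suc N)" "inverse (real (Suc N))"])
    ultimately have "\<bar>f (t *\<^sub>R x)\<bar> \<le> real (Suc N) * K"
      by (simp only: abs_mult abs_of_nat) (intro mult_left_mono, auto)
    moreover have "\<bar>t * f x\<bar> \<le> \<bar>f x\<bar>"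
      using that by (simp add: abs_mult mult_left_le_one_le)
    ultimately show ?thesis
      unfolding g_def by linarith
  qed
  have "g t = 0"
  proof (rule ccontr)
    assume "g t \<noteq> 0"
    then obtain n :: nat where n: "(real (Suc N) * K + \<bar>f x\<bar>) / \<bar>g t\<bar> < real n"
      using reals_Archimedean2 by blast
    have "real n * \<bar>g t\<bar> = \<bar>g (frac (real n * t))\<bar>"
      using g_int[of "frac (real n * t)" "\<lfloor>real n * t\<rfloor>"] g_nat[of n t] abs_mult[of "real n" "g t"]
      by (simp add: frac_def)
    also have "\<dots> \<le> real (Suc N) * K + \<bar>f x\<bar>"
      by (rule g_bnd) (auto simp: frac_lt_1)
    finally show False
      using n \<open>g t \<noteq> 0\<close> by (simp add: field_simps)
  qed
  then show ?thesis
    unfolding g_def by simp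
qed

text \<open>The polarisation P is symmetric and additive. The two-sided bound on Q makes it locally
  bounded, hence bilinear, and the entries of the matrix are the values of P at pairs of basis
  vectors.\<close>

lemma parallelogram_imp_matrix:
  fixes Q :: "real^'n \<Rightarrow> real"
  assumes par: "\<And>x y. Q (x + y) + Q (x - y) = 2 * Q x + 2 * Q y"
    and nonneg: "\<And>x. 0 \<le> Q x" and bnd: "\<And>x. Q x \<le> (norm x)\<^sup>2"
  obtains M :: "real^'n^'n" where "transpose M = M" "\<And>x. Q x = x \<bullet> (M *v x)"
proof -
  define P where "P x y = (Q (x + y) - Q (x - y)) / 4" for x y
  have add: "P (x + y) z = P x z + P y z" for x y z
    unfolding P_def by (rule jordan_von_neumann_additive) (rule par)
  have even: "Q (- x) = Q x" for x
    using par[of 0 x] par[of 0 0] by simp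
  have sym: "P x y = P y x" for x y
    using even[of "x - y"] unfolding P_def by (simp add: add.commute)
  have "\<bar>P x z\<bar> \<le> (1 + norm z)\<^sup>2" if "norm x \<le> 1" for x z
  proof -
    have "norm (x + z) \<le> 1 + norm z" "norm (x - z) \<le> 1 + norm z"
      using that norm_triangle_ineq[of x z] norm_triangle_ineq4[of x z] by linarith+
    then have "(norm (x + z))\<^sup>2 \<le> (1 + norm z)\<^sup>2" "(norm (x - z))\<^sup>2 \<le> (1 + norm z)\<^sup>2"
      by (auto intro: power_mono)
    then have "Q (x + z) \<le> (1 + norm z)\<^sup>2" "Q (x - z) \<le> (1 + norm z)\<^sup>2"
      by (auto intro: order_trans[OF bnd])
    then show ?thesis
      using nonneg[of "x + z"] nonneg[of "x - z"] unfolding P_def by (simp add: abs_le_iff field_simps)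
  qed
  then have "P (t *\<^sub>R x) z = t * P x z" for t x z
    by (intro additive_bounded_imp_scaleR[where f = "\<lambda>x. P x z" and R = 1]) (auto simp: add)
  then have lin: "linear (\<lambda>x. P x z)" for z
    by (intro linearI) (auto simp: add)
  define f where "f q = (\<chi> i. P q (axis i 1))" for q :: "real^'n"
  have "linear f"
    using lin by (auto simp: f_def linear_iff vec_eq_iff)
  have dot: "p \<bullet> f q = P p q" for p q
  proof -
    have "P p q = P (\<Sum>i\<in>UNIV. (p $ i) *\<^sub>R axis i 1) q"
      using basis_expansion[of p] by (simp add: scalar_mult_eq_scaleR)
    also have "\<dots> = (\<Sum>i\<in>UNIV. p $ i * P (axis i 1) q)"
      by (simp add: linear_sum[OF lin] linear_cmul[OF lin])
    also have "\<dots> = p \<bullet> f q"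
      by (simp add: f_def inner_vec_def sym)
    finally show ?thesis by simp
  qed
  show ?thesis
  proof (rule that[of "matrix f"])
    show "transpose (matrix f) = matrix f"
      by (simp add: vec_eq_iff transpose_def matrix_def f_def sym)
    have "Q 0 = 0"
      using par[of 0 0] by simp
    then have "Q x = P x x" for x
      using par[of x x] unfolding P_def by simp
    then show "Q x = x \<bullet> (matrix f *v x)" for x
      by (simp add: matrix_works linear_matrix_vector_mul_eq \<open>linear f\<close> dot)
  qed
qed

lemma symmetric_matrix_polarization:
  fixes M :: "real^'n^'n"
  assumes "transpose M = M"
  shows "4 * (x \<bullet> (M *v y)) = (x + y) \<bullet> (M *v (x + y)) - (x - y) \<bullet> (M *v (x - y))"
proof -
  have "x \<bullet> (M *v y) = y \<bullet> (M *v x)"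
    using dot_lmul_matrix[of x M y] assms by (simp add: inner_commute flip: transpose_matrix_vector)
  then show ?thesis
    by (simp add: matrix_vector_right_distrib matrix_vector_mult_diff_distrib inner_add inner_diff)
qed

text \<open>This gives the uniqueness in the definite description \<open>a_star_inv\<close>.
  Symmetry is what makes it true: an antisymmetric part is invisible to the quadratic form.\<close>

lemma symmetric_matrix_eqI:
  fixes M N :: "real^'n^'n"
  assumes "transpose M = M" "transpose N = N" "\<And>x. x \<bullet> (M *v x) = x \<bullet> (N *v x)"
  shows "M = N"
proof -
  have "x \<bullet> (M *v y) = x \<bullet> (N *v y)" for x y
    using symmetric_matrix_polarization[OF assms(1), of x y]
      symmetric_matrix_polarization[OF assms(2), of x y] assms(3) by simp
  then have "M *v y = N *v y" for y
    using inner_eq_zero_iff[of "M *v y - N *v y"] by (metis inner_diff_right right_minus_eq)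
  then show ?thesis
    by (simp add: matrix_eq)
qed

text \<open>Polarisation replaces the spectral theorem: dropping the nonnegative form at x - y
  leaves 4 x . M y <= |x + y|^2, which is at most 4 |y|^2 once |x| = |y|.\<close>

lemma onorm_symmetric_matrix_le_1:
  fixes M :: "real^'n^'n"
  assumes sym: "transpose M = M" and nonneg: "\<And>x. 0 \<le> x \<bullet> (M *v x)"
    and bnd: "\<And>x. x \<bullet> (M *v x) \<le> (norm x)\<^sup>2"
  shows "onorm ((*v) M) \<le> 1"
proof (rule onorm_le)
  fix y :: "real^'n"
  let ?c = "norm y" and ?m = "norm (M *v y)"
  show "norm (M *v y) \<le> 1 * norm y"
  proof (cases "M *v y = 0")
    case False
    then have m: "?m > 0" by simp
    \<comment> \<open>The vector of length |y| that maximises x . M y.\<close>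
    define x where "x = (?c / ?m) *\<^sub>R (M *v y)"
    have nx: "norm x = ?c"
      using m by (simp add: x_def)
    have "4 * (x \<bullet> (M *v y)) \<le> (norm (x + y))\<^sup>2"
      using symmetric_matrix_polarization[OF sym, of x y] nonneg[of "x - y"] bnd[of "x + y"] by simp
    also have "\<dots> \<le> (?c + ?c)\<^sup>2"
      using norm_triangle_ineq[of x y] nx by (intro power_mono) auto
    finally have "x \<bullet> (M *v y) \<le> ?c * ?c"
      by (simp add: power2_eq_square algebra_simps)
    moreover have "x \<bullet> (M *v y) = ?c * ?m"
      using m by (simp add: x_def dot_square_norm power2_eq_square)
    ultimately have "?c * ?m \<le> ?c * ?c" by simp
    moreover have "?c > 0"
      using False by auto
    ultimately show ?thesis
      by simp
  qed auto
qed

text \<open>The set \<open>T\<close> consists of the values \<open>(B(v,v), l(v))\<close> for \<open>v\<close> in a vector space with a quadratic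
  form \<open>B\<close> and a linear map \<open>l\<close>. One half of the parallelogram law for the supremum comes from replacing
  a pair \<open>v, w\<close> of competitors by \<open>v + w, v - w\<close>; the other half is the first one applied to
  \<open>p + q, p - q\<close>. Completeness of the space is not involved.\<close>

lemma sup_linear_minus_quadratic_matrix:
  fixes T :: "(real \<times> (real^'n)) set"
  assumes zero: "(0, 0) \<in> T"
    and scale: "\<And>t \<beta> l. (\<beta>, l) \<in> T \<Longrightarrow> (t\<^sup>2 * \<beta>, t *\<^sub>R l) \<in> T"
    and add: "\<And>\<beta> l \<beta>' l'. (\<beta>, l) \<in> T \<Longrightarrow> (\<beta>', l') \<in> T \<Longrightarrow>
      \<exists>\<gamma> \<gamma>'. (\<gamma>, l + l') \<in> T \<and> (\<gamma>', l - l') \<in> T \<and> \<gamma> + \<gamma>' = 2 * \<beta> + 2 * \<beta>'"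
    and bnd: "\<And>\<beta> l q. (\<beta>, l) \<in> T \<Longrightarrow> - \<beta> + 2 * (q \<bullet> l) \<le> (norm q)\<^sup>2"
  obtains M :: "real^'n^'n" where "transpose M = M"
    "\<And>q. (SUP (\<beta>, l)\<in>T. ereal (- \<beta> + 2 * (q \<bullet> l))) = ereal (q \<bullet> (M *v q))"
    "\<And>q. 0 \<le> q \<bullet> (M *v q)" "\<And>q. q \<bullet> (M *v q) \<le> (norm q)\<^sup>2"
proof -
  define J where "J q = (\<lambda>(\<beta>, l). - \<beta> + 2 * (q \<bullet> l))" for q :: "real^'n"
  define Q where "Q q = (SUP w\<in>T. J q w)" for q
  have J_le: "J q w \<le> (norm q)\<^sup>2" if "w \<in> T" for q w
    using bnd[of "fst w" "snd w" q] that by (simp add: J_def case_prod_unfold)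
  then have bdd: "bdd_above (J q ` T)" for q
    by (intro bdd_aboveI[of _ "(norm q)\<^sup>2"]) blast
  have J_le_Q: "J q w \<le> Q q" if "w \<in> T" for q w
    unfolding Q_def using bdd that by (rule cSUP_upper2) simp
  have Q_le: "Q q \<le> c" if "\<And>w. w \<in> T \<Longrightarrow> J q w \<le> c" for q c
    unfolding Q_def using that zero by (intro cSUP_least) auto
  have Q_bnd: "Q q \<le> (norm q)\<^sup>2" for q
    using J_le by (rule Q_le)
  have Q_nonneg: "0 \<le> Q q" for q
    using J_le_Q[OF zero, of q] by (simp add: J_def)
  have Q_scale_le: "Q (t *\<^sub>R q) \<le> t\<^sup>2 * Q q" if "t \<noteq> 0" for t q
  proof (rule Q_le)
    fix w assume "w \<in> T"
    obtain \<beta> l where w: "w = (\<beta>, l)" by fastforce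
    \<comment> \<open>A competitor for t q, divided by t, competes for q, with its value divided by
      t^2.\<close>
    have "((1/t)\<^sup>2 * \<beta>, (1/t) *\<^sub>R l) \<in> T"
      using \<open>w \<in> T\<close> unfolding w by (rule scale)
    from J_le_Q[OF this, of q] have "t\<^sup>2 * J q ((1/t)\<^sup>2 * \<beta>, (1/t) *\<^sub>R l) \<le> t\<^sup>2 * Q q"
      by (rule mult_left_mono) simp
    also have "t\<^sup>2 * J q ((1/t)\<^sup>2 * \<beta>, (1/t) *\<^sub>R l) = J (t *\<^sub>R q) w"
      using that by (simp add: w J_def power_divide right_diff_distrib) (simp add: power2_eq_square)
    finally show "J (t *\<^sub>R q) w \<le> t\<^sup>2 * Q q" .
  qed
  have Q_double: "Q (2 *\<^sub>R q) = 4 * Q q" for q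
    using Q_scale_le[of 2 q] Q_scale_le[of "1/2" "2 *\<^sub>R q"] by (simp add: power2_eq_square)
  have le: "2 * Q p + 2 * Q q \<le> Q (p + q) + Q (p - q)" for p q
  proof -
    have "J p w + J q w' \<le> (Q (p + q) + Q (p - q)) / 2" if "w \<in> T" "w' \<in> T" for w w'
    proof -
      obtain \<beta> l \<beta>' l' where w: "w = (\<beta>, l)" "w' = (\<beta>', l')" by fastforce
      obtain \<gamma> \<gamma>' where \<gamma>: "(\<gamma>, l + l') \<in> T" "(\<gamma>', l - l') \<in> T" "\<gamma> + \<gamma>' = 2 * \<beta> + 2 * \<beta>'"
        using add \<open>w \<in> T\<close> \<open>w' \<in> T\<close> unfolding w by blast
      have "2 * J p w + 2 * J q w' = J (p + q) (\<gamma>, l + l') + J (p - q) (\<gamma>', l - l')"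
        using \<gamma>(3) by (simp add: J_def w inner_add inner_diff)
      also have "\<dots> \<le> Q (p + q) + Q (p - q)"
        using \<gamma> by (intro add_mono J_le_Q)
      finally show ?thesis by simp
    qed
    \<comment> \<open>The competitors vary independently, so the suprema are taken in turn: over w
      with w' fixed, then over w'.\<close>
    then have "J p w \<le> (Q (p + q) + Q (p - q)) / 2 - J q w'" if "w \<in> T" "w' \<in> T" for w w'
      using that by (simp add: algebra_simps)
    then have "Q p \<le> (Q (p + q) + Q (p - q)) / 2 - J q w'" if "w' \<in> T" for w'
      using that by (intro Q_le)
    then have "J q w' \<le> (Q (p + q) + Q (p - q)) / 2 - Q p" if "w' \<in> T" for w'
      using that by (simp add: algebra_simps)
    then have "Q q \<le> (Q (p + q) + Q (p - q)) / 2 - Q p"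
      by (intro Q_le)
    then show ?thesis by argo
  qed
  have "Q (p + q) + Q (p - q) = 2 * Q p + 2 * Q q" for p q
    using le[of p q] le[of "p + q" "p - q"] Q_double[of p] Q_double[of q]
    by (simp add: scaleR_2 add.commute)
  then obtain M :: "real^'n^'n" where M: "transpose M = M" "\<And>x. Q x = x \<bullet> (M *v x)"
    using Q_nonneg Q_bnd by (rule parallelogram_imp_matrix) blast
  have "(SUP (\<beta>, l)\<in>T. ereal (- \<beta> + 2 * (q \<bullet> l))) = ereal (Q q)" for q
  proof -
    have "(SUP (\<beta>, l)\<in>T. ereal (- \<beta> + 2 * (q \<bullet> l))) = (SUP w\<in>T. ereal (J q w))"
      by (intro SUP_cong) (auto simp: J_def)
    also have "\<dots> = ereal (Q q)"
    proof (rule antisym)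
      show "(SUP w\<in>T. ereal (J q w)) \<le> ereal (Q q)"
        using J_le_Q by (intro SUP_least) auto
      show "ereal (Q q) \<le> (SUP w\<in>T. ereal (J q w))"
        unfolding le_SUP_iff
      proof (intro allI impI)
        fix y assume y: "y < ereal (Q q)"
        show "\<exists>w\<in>T. y < ereal (J q w)"
        proof (cases y)
          case (real r)
          then show ?thesis
            using y less_cSUP_iff[of T "J q" r] zero bdd[of q] unfolding Q_def by auto
        qed (use y zero in auto)
      qed
    qed
    finally show ?thesis .
  qed
  then show ?thesis
    using that[OF M(1)] Q_nonneg Q_bnd unfolding M(2) by blast
qed

section \<open>Geometric sums over the scales k <= 0\<close>

lemma infsum_ennreal_geometric_le:
  fixes f :: "int \<Rightarrow> ennreal"
  assumes f: "\<And>k. k \<le> 0 \<Longrightarrow> f k \<le> ennreal (D * q ^ nat (- k))"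
    and q: "0 \<le> q" "q < 1" and "0 \<le> D"
  shows "(\<Sum>\<^sub>\<infinity>k\<in>{..0}. f k) \<le> ennreal (D / (1 - q))"
proof -
  \<comment> \<open>The unordered sum of nonnegative terms is the supremum of its finite partial
    sums, and k -> -k turns a finite set of scales into a finite set of exponents.\<close>
  have "sum f F \<le> ennreal (D / (1 - q))" if F: "finite F" "F \<subseteq> {..0}" for F
  proof -
    have "sum f F \<le> (\<Sum>k\<in>F. ennreal (D * q ^ nat (- k)))"
      using F f by (intro sum_mono) auto
    also have "\<dots> = ennreal (D * (\<Sum>k\<in>F. q ^ nat (- k)))"
      using q \<open>0 \<le> D\<close> by (simp add: sum_ennreal sum_distrib_left)
    also have "(\<Sum>k\<in>F. q ^ nat (- k)) = (\<Sum>n\<in>(\<lambda>k. nat (- k)) ` F. q ^ n)"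
    proof -
      have "inj_on (\<lambda>k. nat (- k)) F"
        using F(2) by (intro inj_onI) (simp add: subset_iff eq_nat_nat_iff)
      then show ?thesis
        by (simp add: sum.reindex)
    qed
    also have "(\<Sum>n\<in>(\<lambda>k. nat (- k)) ` F. q ^ n) \<le> (\<Sum>n. q ^ n)"
      using F q by (intro sum_le_suminf) auto
    also have "(\<Sum>n. q ^ n) = 1 / (1 - q)"
      using q by (intro suminf_geometric) auto
    finally show ?thesis
      using \<open>0 \<le> D\<close> by (simp add: mult_left_mono ennreal_leI)
  qed
  then show ?thesis
    by (subst nonneg_infsum_complete) (auto intro!: SUP_least)
qed

section \<open>The weighted Sobolev space of a bounded scalar field\<close>

lemma C_k_imp_continuous_on: "C_k k f \<Longrightarrow> continuous_on UNIV f"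
  by (cases k) (auto intro: differentiable_imp_continuous_on)

lemma frechet_derivative_add:
  assumes "f differentiable at x" "g differentiable at x"
  shows "frechet_derivative (\<lambda>x. f x + g x) (at x) = (\<lambda>v. frechet_derivative f (at x) v + frechet_derivative g (at x) v)"
  using assms by (intro frechet_derivative_at[symmetric] has_derivative_add)
    (simp_all flip: frechet_derivative_works)

lemma frechet_derivative_cmult:
  fixes f :: "'a::real_normed_vector \<Rightarrow> real"
  assumes "f differentiable at x"
  shows "frechet_derivative (\<lambda>x. c * f x) (at x) = (\<lambda>v. c * frechet_derivative f (at x) v)"
  using assms by (intro frechet_derivative_at[symmetric] has_derivative_mult_right)
    (simp_all flip: frechet_derivative_works)

lemma C_k_add: "C_k k f \<Longrightarrow> C_k k g \<Longrightarrow> C_k k (\<lambda>x. f x + g x)"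
proof (induction k arbitrary: f g)
  case (Suc k)
  then have "f differentiable at x" "g differentiable at x" for x
    by (auto simp: differentiable_on_eq_differentiable_at)
  with Suc show ?case
    by (auto simp: frechet_derivative_add intro!: differentiable_on_add)
qed (auto intro: continuous_on_add)

lemma C_k_cmult: "C_k k f \<Longrightarrow> C_k k (\<lambda>x. c * f x)"
proof (induction k arbitrary: f)
  case (Suc k)
  then have "f differentiable at x" for x
    by (auto simp: differentiable_on_eq_differentiable_at)
  with Suc show ?case
    by (auto simp: frechet_derivative_cmult intro!: differentiable_on_mult)
qed (auto intro: continuous_intros)

lemma C_infinity_add: "C_infinity f \<Longrightarrow> C_infinity g \<Longrightarrow> C_infinity (\<lambda>x. f x + g x)"
  and C_infinity_cmult: "C_infinity f \<Longrightarrow> C_infinity (\<lambda>x. c * f x)"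
  by (auto simp: C_infinity_def intro: C_k_add C_k_cmult)

lemma C_infinity_imp_continuous_on: "C_infinity f \<Longrightarrow> continuous_on UNIV f"
  by (auto simp: C_infinity_def intro: C_k_imp_continuous_on)

lemma C_infinity_imp_differentiable: "C_infinity f \<Longrightarrow> f differentiable at x"
  unfolding C_infinity_def
  by (drule spec[of _ "Suc 0"]) (auto simp: differentiable_on_eq_differentiable_at)

lemma continuous_on_grad:
  fixes f :: "real^'n \<Rightarrow> real"
  assumes "C_infinity f"
  shows "continuous_on UNIV (grad f)"
proof -
  have "C_k (Suc 0) f"
    using assms by (simp only: C_infinity_def)
  then show ?thesis
    unfolding grad_def[abs_def] by (intro continuous_on_vec_lambda) simp
qed

lemma grad_add:
  "C_infinity f \<Longrightarrow> C_infinity g \<Longrightarrow> grad (\<lambda>x. f x + g x) x = grad f x + grad g x"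
  by (simp add: grad_def vec_eq_iff frechet_derivative_add C_infinity_imp_differentiable)

lemma grad_cmult: "C_infinity f \<Longrightarrow> grad (\<lambda>x. c * f x) x = c *\<^sub>R grad f x"
  by (simp add: grad_def vec_eq_iff frechet_derivative_cmult C_infinity_imp_differentiable)

lemma mat_mult_vector: "mat c *v x = c *\<^sub>R (x :: real^'n)"
  by (simp add: vec_eq_iff mat_def matrix_vector_mult_def if_distrib[of "\<lambda>y. y * _"] cong: if_cong)

lemma norm_add_sq_le: "(norm (x + y))\<^sup>2 \<le> 2 * (norm x)\<^sup>2 + 2 * (norm (y::'a::real_normed_vector))\<^sup>2"
proof -
  have "(norm (x + y))\<^sup>2 \<le> (norm x + norm y)\<^sup>2"
    by (intro power_mono norm_triangle_ineq) simp
  also have "\<dots> \<le> 2 * (norm x)\<^sup>2 + 2 * (norm y)\<^sup>2"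
    using zero_le_power2[of "norm x - norm y"] by (simp add: power2_sum power2_diff)
  finally show ?thesis .
qed

text \<open>\<open>B\<close> provides integrability and appears in no bound derived here, so its
  blow-up as \<open>\<delta>\<close> tends to 0 is harmless. The estimates come from
  \<open>one_le_b\<close>.\<close>

locale bounded_scalar_field =
  fixes b :: "real^'n \<Rightarrow> real" and U :: "(real^'n) set" and B :: real
  assumes b_meas [measurable]: "b \<in> borel_measurable borel"
    and one_le_b: "1 \<le> b x" and b_le: "b x \<le> B"
    and U_bounded: "bounded U" and U_lmeasurable: "U \<in> lmeasurable"
    and U_pos: "0 < measure lebesgue U"
begin

abbreviation "L \<equiv> lebesgue_on U"
abbreviation "a \<equiv> (\<lambda>x. mat (b x)) :: 'n field"

lemma borel_measurable_L: "f \<in> borel_measurable borel \<Longrightarrow> f \<in> borel_measurable L"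
  by (intro measurable_restrict_space1 measurable_completion) simp

lemma b_measL [measurable]: "b \<in> borel_measurable L"
  by (rule borel_measurable_L) simp

lemma measurable_C_infinity:
  assumes "C_infinity f"
  shows "f \<in> borel_measurable L" "grad f \<in> borel_measurable L"
  using assms
  by (auto intro!: borel_measurable_L borel_measurable_continuous_onI C_infinity_imp_continuous_on continuous_on_grad)

lemma finite_measure_L: "finite_measure L"
  using U_lmeasurable by (simp add: finite_measure_lebesgue_on)

lemma measure_L: "measure L (space L) = measure lebesgue U"
  using U_lmeasurable by (simp add: measure_restrict_space fmeasurableD)

lemma grad_bounded:
  assumes "C_infinity f"
  obtains K where "0 \<le> K" "\<And>x. x \<in> U \<Longrightarrow> norm (grad f x) \<le> K"
proof -
  have "compact (grad f ` closure U)"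
    using assms U_bounded
    by (intro compact_continuous_image continuous_on_subset[OF continuous_on_grad]) (auto simp: compact_closure)
  then obtain K where "0 < K" "\<forall>y\<in>grad f ` closure U. norm y \<le> K"
    using compact_imp_bounded bounded_pos by metis
  then show ?thesis
    using closure_subset[of U] by (intro that[of K]) auto
qed

text \<open>The values are in \<open>ennreal\<close> because an arbitrary pair may be infinitely far
  away; convergence to 0 then carries the finiteness of the norm of the limit.\<close>

definition dist_sq :: "(real^'n \<Rightarrow> real) \<Rightarrow> (real^'n \<Rightarrow> real) \<times> (real^'n \<Rightarrow> real^'n) \<Rightarrow> ennreal" where
  "dist_sq \<phi> = (\<lambda>(u, g). \<integral>\<^sup>+x. ennreal ((\<phi> x - u x)\<^sup>2 + b x * (norm (grad \<phi> x - g x))\<^sup>2) \<partial>L)"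

lemma H1_iff:
  "(u, g) \<in> H1 a U \<longleftrightarrow> u \<in> borel_measurable L \<and> g \<in> borel_measurable L \<and>
     (\<exists>\<phi>. (\<forall>n::nat. C_infinity (\<phi> n)) \<and> (\<lambda>n. dist_sq (\<phi> n) (u, g)) \<longlonglongrightarrow> 0)"
  by (simp add: H1_def dist_sq_def mat_mult_vector dot_square_norm)

section \<open>Linear structure and integrability in the weighted Sobolev space\<close>

lemma H1_scale:
  assumes "(u, g) \<in> H1 a U"
  shows "((\<lambda>x. t * u x), (\<lambda>x. t *\<^sub>R g x)) \<in> H1 a U"
proof -
  from assms obtain \<phi> where [measurable]: "u \<in> borel_measurable L" "g \<in> borel_measurable L"
    and \<phi>: "\<And>n::nat. C_infinity (\<phi> n)" and lim: "(\<lambda>n. dist_sq (\<phi> n) (u, g)) \<longlonglongrightarrow> 0"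
    unfolding H1_iff by blast
  note [measurable] = measurable_C_infinity[OF \<phi>]
  have "dist_sq (\<lambda>x. t * \<phi> n x) ((\<lambda>x. t * u x), (\<lambda>x. t *\<^sub>R g x)) = ennreal (t\<^sup>2) * dist_sq (\<phi> n) (u, g)" for n
  proof -
    have "(t * \<phi> n x - t * u x)\<^sup>2 + b x * (norm (grad (\<lambda>x. t * \<phi> n x) x - t *\<^sub>R g x))\<^sup>2
       = t\<^sup>2 * ((\<phi> n x - u x)\<^sup>2 + b x * (norm (grad (\<phi> n) x - g x))\<^sup>2)" for x
    proof -
      have "t * \<phi> n x - t * u x = t * (\<phi> n x - u x)"
        by (simp add: right_diff_distrib)
      moreover have "grad (\<lambda>x. t * \<phi> n x) x - t *\<^sub>R g x = t *\<^sub>R (grad (\<phi> n) x - g x)"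
        by (simp add: grad_cmult \<phi> scaleR_diff_right)
      ultimately show ?thesis
        by (simp only: norm_scaleR power_mult_distrib power2_abs) (simp add: distrib_left)
    qed
    then show ?thesis
      unfolding dist_sq_def by (simp add: ennreal_mult' nn_integral_cmult)
  qed
  moreover have "(\<lambda>n. ennreal (t\<^sup>2) * dist_sq (\<phi> n) (u, g)) \<longlonglongrightarrow> ennreal (t\<^sup>2) * 0"
    by (intro ennreal_tendsto_cmult lim) simp
  ultimately show ?thesis
    unfolding H1_iff by (intro conjI exI[of _ "\<lambda>n x. t * \<phi> n x"]) (auto intro: C_infinity_cmult \<phi>)
qed

lemma H1_add:
  assumes "(u, g) \<in> H1 a U" "(v, h) \<in> H1 a U"
  shows "((\<lambda>x. u x + v x), (\<lambda>x. g x + h x)) \<in> H1 a U"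
proof -
  from assms(1) obtain \<phi> where [measurable]: "u \<in> borel_measurable L" "g \<in> borel_measurable L"
    and \<phi>: "\<And>n::nat. C_infinity (\<phi> n)" and lim1: "(\<lambda>n. dist_sq (\<phi> n) (u, g)) \<longlonglongrightarrow> 0"
    unfolding H1_iff by blast
  from assms(2) obtain \<psi> where [measurable]: "v \<in> borel_measurable L" "h \<in> borel_measurable L"
    and \<psi>: "\<And>n::nat. C_infinity (\<psi> n)" and lim2: "(\<lambda>n. dist_sq (\<psi> n) (v, h)) \<longlonglongrightarrow> 0"
    unfolding H1_iff by blast
  note [measurable] = measurable_C_infinity[OF \<phi>] measurable_C_infinity[OF \<psi>]
  \<comment> \<open>For squared distances the triangle inequality holds up to a factor 2, which does
    not affect convergence to 0.\<close>
  have le: "dist_sq (\<lambda>x. \<phi> n x + \<psi> n x) ((\<lambda>x. u x + v x), (\<lambda>x. g x + h x))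
      \<le> 2 * dist_sq (\<phi> n) (u, g) + 2 * dist_sq (\<psi> n) (v, h)" for n
  proof -
    define F where "F x = (\<phi> n x - u x)\<^sup>2 + b x * (norm (grad (\<phi> n) x - g x))\<^sup>2" for x
    define G where "G x = (\<psi> n x - v x)\<^sup>2 + b x * (norm (grad (\<psi> n) x - h x))\<^sup>2" for x
    have b0: "0 \<le> b x" for x
      using one_le_b[of x] by linarith
    have FG: "0 \<le> F x" "0 \<le> G x" for x
      using b0 by (auto simp: F_def G_def)
    have [measurable]: "F \<in> borel_measurable L" "G \<in> borel_measurable L"
      unfolding F_def[abs_def] G_def[abs_def] by measurable
    have sum_le: "(\<phi> n x + \<psi> n x - (u x + v x))\<^sup>2 + b x * (norm (grad (\<lambda>x. \<phi> n x + \<psi> n x) x - (g x + h x)))\<^sup>2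
        \<le> 2 * F x + 2 * G x" for x
    proof -
      have "(\<phi> n x + \<psi> n x - (u x + v x))\<^sup>2 \<le> 2 * (\<phi> n x - u x)\<^sup>2 + 2 * (\<psi> n x - v x)\<^sup>2"
        using norm_add_sq_le[of "\<phi> n x - u x" "\<psi> n x - v x"] by (simp add: algebra_simps)
      moreover have "(norm (grad (\<lambda>x. \<phi> n x + \<psi> n x) x - (g x + h x)))\<^sup>2
          \<le> 2 * (norm (grad (\<phi> n) x - g x))\<^sup>2 + 2 * (norm (grad (\<psi> n) x - h x))\<^sup>2"
        using norm_add_sq_le[of "grad (\<phi> n) x - g x" "grad (\<psi> n) x - h x"]
        by (simp only: grad_add[OF \<phi> \<psi>] add_diff_add)
      then have "b x * (norm (grad (\<lambda>x. \<phi> n x + \<psi> n x) x - (g x + h x)))\<^sup>2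
          \<le> b x * (2 * (norm (grad (\<phi> n) x - g x))\<^sup>2 + 2 * (norm (grad (\<psi> n) x - h x))\<^sup>2)"
        by (intro mult_left_mono b0)
      ultimately show ?thesis
        unfolding F_def G_def by (simp only: distrib_left mult.left_commute[of "b x" 2])
    qed
    then have "ennreal ((\<phi> n x + \<psi> n x - (u x + v x))\<^sup>2 + b x * (norm (grad (\<lambda>x. \<phi> n x + \<psi> n x) x - (g x + h x)))\<^sup>2)
        \<le> 2 * ennreal (F x) + 2 * ennreal (G x)" for x
    proof -
      have "ennreal (2 * F x + 2 * G x) = 2 * ennreal (F x) + 2 * ennreal (G x)"
        using FG by (simp only: ennreal_plus mult_nonneg_nonneg zero_le_numeral ennreal_mult ennreal_numeral)
      then show ?thesis
        using ennreal_leI[OF sum_le[of x]] by simp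
    qed
    then have "dist_sq (\<lambda>x. \<phi> n x + \<psi> n x) ((\<lambda>x. u x + v x), (\<lambda>x. g x + h x))
        \<le> (\<integral>\<^sup>+x. 2 * ennreal (F x) + 2 * ennreal (G x) \<partial>L)"
      unfolding dist_sq_def prod.case by (rule nn_integral_mono)
    also have "\<dots> = 2 * dist_sq (\<phi> n) (u, g) + 2 * dist_sq (\<psi> n) (v, h)"
    proof -
      have "(\<integral>\<^sup>+x. 2 * ennreal (F x) + 2 * ennreal (G x) \<partial>L)
          = 2 * (\<integral>\<^sup>+x. ennreal (F x) \<partial>L) + 2 * (\<integral>\<^sup>+x. ennreal (G x) \<partial>L)"
        by (subst nn_integral_add) (simp_all add: nn_integral_cmult)
      then show ?thesis
        by (simp only: dist_sq_def prod.case F_def G_def)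
    qed
    finally show ?thesis .
  qed
  have lim0: "(\<lambda>n. 2 * dist_sq (\<phi> n) (u, g) + 2 * dist_sq (\<psi> n) (v, h)) \<longlonglongrightarrow> 2 * 0 + 2 * 0"
    by (intro tendsto_add ennreal_tendsto_cmult lim1 lim2) auto
  have lim: "(\<lambda>n. dist_sq (\<lambda>x. \<phi> n x + \<psi> n x) ((\<lambda>x. u x + v x), (\<lambda>x. g x + h x))) \<longlonglongrightarrow> 0"
    by (intro tendsto_sandwich[OF _ _ tendsto_const lim0[simplified]] always_eventually allI le zero_le)
  show ?thesis
    unfolding H1_iff
    by (intro conjI exI[of _ "\<lambda>n x. \<phi> n x + \<psi> n x"] allI C_infinity_add \<phi> \<psi> lim) measurable
qed

text \<open>One smooth approximant at finite distance suffices: its gradient is bounded on the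
  bounded set U, and b >= 1 lets the weighted distance control the unweighted one.\<close>

lemma H1_integrable_norm_sq:
  assumes "(u, g) \<in> H1 a U"
  shows "integrable L (\<lambda>x. (norm (g x))\<^sup>2)"
proof -
  from assms obtain \<phi> where [measurable]: "u \<in> borel_measurable L" "g \<in> borel_measurable L"
    and \<phi>: "\<And>n::nat. C_infinity (\<phi> n)" and lim: "(\<lambda>n. dist_sq (\<phi> n) (u, g)) \<longlonglongrightarrow> 0"
    unfolding H1_iff by blast
  note [measurable] = measurable_C_infinity[OF \<phi>]
  have "\<forall>\<^sub>F n in sequentially. dist_sq (\<phi> n) (u, g) < 1"
    using lim by (rule order_tendstoD) simp
  then obtain n where n: "dist_sq (\<phi> n) (u, g) < 1"
    using eventually_happens'[OF sequentially_bot] by blast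
  obtain K where K: "\<And>x. x \<in> U \<Longrightarrow> norm (grad (\<phi> n) x) \<le> K" "0 \<le> K"
    using grad_bounded[OF \<phi>] by blast
  define F where "F x = (\<phi> n x - u x)\<^sup>2 + b x * (norm (grad (\<phi> n) x - g x))\<^sup>2" for x
  have [measurable]: "F \<in> borel_measurable L"
    unfolding F_def[abs_def] by measurable
  have F_ge: "(norm (grad (\<phi> n) x - g x))\<^sup>2 \<le> F x" for x
    using mult_right_mono[OF one_le_b[of x] zero_le_power2[of "norm (grad (\<phi> n) x - g x)"]]
    unfolding F_def using zero_le_power2[of "\<phi> n x - u x"] by (simp only: mult_1 add_increasing)
  have F0: "0 \<le> F x" for x
    by (rule order_trans[OF zero_le_power2 F_ge])
  have "integrable L F"
    using n F0 less_trans[OF n ennreal_one_less_top] unfolding dist_sq_def F_def[abs_def]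
    by (intro integrableI_nonneg) auto
  moreover have "integrable L (\<lambda>x. 2 * K\<^sup>2)"
    using finite_measure_L by (intro finite_measure.integrable_const)
  ultimately have int: "integrable L (\<lambda>x. 2 * K\<^sup>2 + 2 * F x)"
    by simp
  have "(norm (g x))\<^sup>2 \<le> 2 * K\<^sup>2 + 2 * F x" if "x \<in> U" for x
  proof -
    have "(norm (g x))\<^sup>2 \<le> 2 * (norm (grad (\<phi> n) x))\<^sup>2 + 2 * (norm (grad (\<phi> n) x - g x))\<^sup>2"
      using norm_add_sq_le[of "grad (\<phi> n) x" "g x - grad (\<phi> n) x"] by (simp add: norm_minus_commute)
    also have "\<dots> \<le> 2 * K\<^sup>2 + 2 * F x"
      using K that F_ge[of x] by (intro add_mono) (auto intro: power_mono)
    finally show ?thesis .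
  qed
  then have "AE x in L. norm ((norm (g x))\<^sup>2) \<le> norm (2 * K\<^sup>2 + 2 * F x)"
    using F0 by (intro AE_I2) (simp add: abs_of_nonneg)
  then show ?thesis
    by (intro Bochner_Integration.integrable_bound[OF int]) auto
qed

text \<open>The integral of a nonintegrable function is 0 by convention, so the linearity of the
  weak equation and of the averages has to be secured by integrability.\<close>

lemma H1_integrable:
  assumes "(u, g) \<in> H1 a U"
  shows "integrable L g" and "integrable L (\<lambda>x. b x * (norm (g x))\<^sup>2)"
    and "C_infinity \<psi> \<Longrightarrow> integrable L (\<lambda>x. b x * (grad \<psi> x \<bullet> g x))"
proof -
  have [measurable]: "g \<in> borel_measurable L"
    using assms by (simp add: H1_iff)
  note sq = H1_integrable_norm_sq[OF assms]
  have one: "integrable L (\<lambda>x. c)" for c :: real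
    using finite_measure_L by (intro finite_measure.integrable_const)
  have le: "norm (g x) \<le> 1 + (norm (g x))\<^sup>2" for x
    using zero_le_power2[of "norm (g x) - 1/2"] by (simp add: power2_diff power_divide)
  have int1: "integrable L (\<lambda>x. 1 + (norm (g x))\<^sup>2)"
    using sq one by simp
  show g: "integrable L g"
    using le by (intro Bochner_Integration.integrable_bound[OF int1]) auto
  have b_abs: "\<bar>b x\<bar> \<le> B" for x
    using one_le_b[of x] b_le[of x] by simp
  show "integrable L (\<lambda>x. b x * (norm (g x))\<^sup>2)"
  proof (rule Bochner_Integration.integrable_bound[OF integrable_mult_right[OF sq, of B]])
    have "\<bar>b x\<bar> * (norm (g x))\<^sup>2 \<le> \<bar>B\<bar> * (norm (g x))\<^sup>2" for x
      using b_abs[of x] by (intro mult_right_mono) auto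
    then show "AE x in L. norm (b x * (norm (g x))\<^sup>2) \<le> norm (B * (norm (g x))\<^sup>2)"
      by (simp add: abs_mult)
  qed measurable
  assume \<psi>: "C_infinity \<psi>"
  note [measurable] = measurable_C_infinity[OF \<psi>]
  obtain K where K: "\<And>x. x \<in> U \<Longrightarrow> norm (grad \<psi> x) \<le> K" "0 \<le> K"
    using grad_bounded[OF \<psi>] by blast
  have B: "0 \<le> B"
    using b_abs[of 0] by linarith
  have "\<bar>b x * (grad \<psi> x \<bullet> g x)\<bar> \<le> B * K * norm (g x)" if "x \<in> U" for x
  proof -
    have "\<bar>grad \<psi> x \<bullet> g x\<bar> \<le> K * norm (g x)"
      using Cauchy_Schwarz_ineq2[of "grad \<psi> x" "g x"] mult_right_mono[OF K(1)[OF that], of "norm (g x)"]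
      by simp
    then show ?thesis
      using mult_mono[OF b_abs[of x], of _ "K * norm (g x)"] B by (simp add: abs_mult mult.assoc)
  qed
  then show "integrable L (\<lambda>x. b x * (grad \<psi> x \<bullet> g x))"
    using B K by (intro Bochner_Integration.integrable_bound[OF integrable_mult_right[OF integrable_norm[OF g], of "B * K"]] AE_I2)
      simp_all
qed

lemma solutions_iff:
  "(u, g) \<in> solutions a U \<longleftrightarrow> (u, g) \<in> H1 a U \<and>
     (\<forall>\<psi>\<in>C_c_infinity U. (\<integral>x. b x * (grad \<psi> x \<bullet> g x) \<partial>L) = 0)"
  by (simp add: solutions_def mat_mult_vector)

lemma solutions_scale:
  assumes "(u, g) \<in> solutions a U"
  shows "((\<lambda>x. t * u x), (\<lambda>x. t *\<^sub>R g x)) \<in> solutions a U"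
  using assms by (auto simp: solutions_iff H1_scale mult.left_commute[of _ t])

lemma solutions_add:
  assumes "(u, g) \<in> solutions a U" "(v, h) \<in> solutions a U"
  shows "((\<lambda>x. u x + v x), (\<lambda>x. g x + h x)) \<in> solutions a U"
  unfolding solutions_iff
proof (intro conjI ballI)
  show "((\<lambda>x. u x + v x), (\<lambda>x. g x + h x)) \<in> H1 a U"
    using assms by (intro H1_add) (auto simp: solutions_iff)
  fix \<psi> assume \<psi>: "\<psi> \<in> C_c_infinity U"
  then have "integrable L (\<lambda>x. b x * (grad \<psi> x \<bullet> g x))" "integrable L (\<lambda>x. b x * (grad \<psi> x \<bullet> h x))"
    using assms by (auto simp: solutions_iff C_c_infinity_def intro: H1_integrable(3))
  then show "(\<integral>x. b x * (grad \<psi> x \<bullet> (g x + h x)) \<partial>L) = 0"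
    using assms \<psi> by (simp add: solutions_iff inner_add_right distrib_left)
qed

lemma zero_solution: "((\<lambda>x. 0), (\<lambda>x. 0)) \<in> solutions a U"
proof -
  have "C_k k (\<lambda>x::real^'n. 0)" for k
    by (induction k) auto
  then have "C_infinity (\<lambda>x::real^'n. 0)"
    by (simp add: C_infinity_def)
  moreover have "grad (\<lambda>x::real^'n. 0) x = 0" for x
    by (simp add: grad_def vec_eq_iff)
  ultimately show ?thesis
    by (auto simp: solutions_iff H1_iff dist_sq_def intro!: exI[of _ "\<lambda>n x. 0"])
qed

section \<open>The dual coefficient of a field bounded below by 1\<close>

definition energy :: "(real^'n \<Rightarrow> real^'n) \<Rightarrow> real" where
  "energy g = (\<integral>x. b x * (norm (g x))\<^sup>2 \<partial>L) / measure lebesgue U"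

definition mean :: "(real^'n \<Rightarrow> real^'n) \<Rightarrow> real^'n" where
  "mean g = (\<integral>x. g x \<partial>L) /\<^sub>R measure lebesgue U"

text \<open>The functional sees a competitor only through one number and one vector. These pairs
  form the set T of \<open>sup_linear_minus_quadratic_matrix\<close>.\<close>

lemma avg_eq_energy_mean:
  assumes "(u, g) \<in> H1 a U"
  shows "avg U (\<lambda>x. - (g x \<bullet> (a x *v g x)) + 2 * (q \<bullet> g x)) = - energy g + 2 * (q \<bullet> mean g)"
  using H1_integrable(1,2)[OF assms]
  by (simp add: avg_def energy_def mean_def mat_mult_vector dot_square_norm diff_divide_distrib) (simp add: divide_inverse algebra_simps)

text \<open>With b >= 1 the integrand is at most -|g|^2 + 2 q . g = |q|^2 - |q - g|^2.\<close>

lemma energy_mean_le: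
  assumes "(u, g) \<in> H1 a U"
  shows "- energy g + 2 * (q \<bullet> mean g) \<le> (norm q)\<^sup>2"
proof -
  have "- (b x * (norm (g x))\<^sup>2) + 2 * (q \<bullet> g x) \<le> (norm q)\<^sup>2" for x
  proof -
    have "1 * (norm (g x))\<^sup>2 \<le> b x * (norm (g x))\<^sup>2"
      by (intro mult_right_mono one_le_b) simp
    moreover have "0 \<le> (norm (q - g x))\<^sup>2" by simp
    ultimately show ?thesis
      by (simp add: power2_norm_eq_inner inner_diff inner_commute)
  qed
  then have "(\<integral>x. - (b x * (norm (g x))\<^sup>2) + 2 * (q \<bullet> g x) \<partial>L) \<le> (\<integral>x. (norm q)\<^sup>2 \<partial>L)"
    using H1_integrable(1,2)[OF assms] finite_measure_L
    by (intro integral_mono finite_measure.integrable_const) auto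
  also have "\<dots> = (norm q)\<^sup>2 * measure lebesgue U"
    using measure_L by simp
  finally have "(\<integral>x. - (b x * (norm (g x))\<^sup>2) + 2 * (q \<bullet> g x) \<partial>L) / measure lebesgue U \<le> (norm q)\<^sup>2"
    using U_pos by (simp add: divide_le_eq)
  then show ?thesis
    using avg_eq_energy_mean[OF assms, of q] by (simp add: avg_def mat_mult_vector dot_square_norm)
qed

lemma onorm_a_star_inv_le_1: "onorm ((*v) (a_star_inv a U)) \<le> 1"
proof -
  define T where "T = (\<lambda>(u, g). (energy g, mean g)) ` solutions a U"
  have inT: "(energy g, mean g) \<in> T" if "(u, g) \<in> solutions a U" for u g
    using that unfolding T_def by (intro image_eqI[of _ _ "(u, g)"]) auto
  obtain M :: "real^'n^'n" where M: "transpose M = M"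
    "\<And>q. (SUP (\<beta>, l)\<in>T. ereal (- \<beta> + 2 * (q \<bullet> l))) = ereal (q \<bullet> (M *v q))"
    "\<And>q. 0 \<le> q \<bullet> (M *v q)" "\<And>q. q \<bullet> (M *v q) \<le> (norm q)\<^sup>2"
  proof (rule sup_linear_minus_quadratic_matrix[of T])
    show "(0, 0) \<in> T"
      using inT[OF zero_solution] by (simp add: energy_def mean_def)
  next
    fix t \<beta> and l :: "real^'n" assume "(\<beta>, l) \<in> T"
    then obtain u g where ug: "(u, g) \<in> solutions a U" "\<beta> = energy g" "l = mean g"
      by (auto simp: T_def)
    have "energy (\<lambda>x. t *\<^sub>R g x) = t\<^sup>2 * energy g"
      by (simp add: energy_def power_mult_distrib mult.left_commute[of _ "t\<^sup>2"])
    moreover have "mean (\<lambda>x. t *\<^sub>R g x) = t *\<^sub>R mean g"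
      by (simp add: mean_def)
    ultimately show "(t\<^sup>2 * \<beta>, t *\<^sub>R l) \<in> T"
      using inT[OF solutions_scale[OF ug(1), of t]] ug by simp
  next
    fix \<beta> \<beta>' and l l' :: "real^'n" assume "(\<beta>, l) \<in> T" "(\<beta>', l') \<in> T"
    then obtain u g v h where ug: "(u, g) \<in> solutions a U" "\<beta> = energy g" "l = mean g"
      and vh: "(v, h) \<in> solutions a U" "\<beta>' = energy h" "l' = mean h"
      by (auto simp: T_def)
    \<comment> \<open>The difference is written with the factor -1 so that it is covered by closure
      under sums and multiples.\<close>
    have minus: "((\<lambda>x. u x + (- 1) * v x), (\<lambda>x. g x + (- 1) *\<^sub>R h x)) \<in> solutions a U"
      by (intro solutions_add solutions_scale ug vh)
    have H: "(u, g) \<in> H1 a U" "(v, h) \<in> H1 a U" "((\<lambda>x. u x + v x), (\<lambda>x. g x + h x)) \<in> H1 a U"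
      "((\<lambda>x. u x + (- 1) * v x), (\<lambda>x. g x + (- 1) *\<^sub>R h x)) \<in> H1 a U"
      using ug(1) vh(1) solutions_add[OF ug(1) vh(1)] minus by (auto simp: solutions_iff)
    note int = H[THEN H1_integrable(1)] H[THEN H1_integrable(2)]
    \<comment> \<open>The parallelogram law holds pointwise for the weighted norm and passes to the
      energies because all four terms are integrable.\<close>
    have "(\<integral>x. b x * (norm (g x + h x))\<^sup>2 \<partial>L) + (\<integral>x. b x * (norm (g x + (- 1) *\<^sub>R h x))\<^sup>2 \<partial>L)
        = (\<integral>x. b x * (norm (g x + h x))\<^sup>2 + b x * (norm (g x + (- 1) *\<^sub>R h x))\<^sup>2 \<partial>L)"
      using int by (intro Bochner_Integration.integral_add[symmetric])
    also have "\<dots> = (\<integral>x. 2 * (b x * (norm (g x))\<^sup>2) + 2 * (b x * (norm (h x))\<^sup>2) \<partial>L)"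
      by (intro Bochner_Integration.integral_cong refl)
        (simp add: power2_norm_eq_inner inner_add inner_diff algebra_simps)
    also have "\<dots> = 2 * (\<integral>x. b x * (norm (g x))\<^sup>2 \<partial>L) + 2 * (\<integral>x. b x * (norm (h x))\<^sup>2 \<partial>L)"
      using int by (subst Bochner_Integration.integral_add) auto
    finally have "energy (\<lambda>x. g x + h x) + energy (\<lambda>x. g x + (- 1) *\<^sub>R h x)
        = (2 * (\<integral>x. b x * (norm (g x))\<^sup>2 \<partial>L) + 2 * (\<integral>x. b x * (norm (h x))\<^sup>2 \<partial>L)) / measure lebesgue U"
      unfolding energy_def add_divide_distrib[symmetric] by (rule arg_cong)
    then have "energy (\<lambda>x. g x + h x) + energy (\<lambda>x. g x + (- 1) *\<^sub>R h x) = 2 * \<beta> + 2 * \<beta>'"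
      by (simp only: energy_def ug vh add_divide_distrib times_divide_eq_right)
    moreover have "mean (\<lambda>x. g x + h x) = l + l'" "mean (\<lambda>x. g x + (- 1) *\<^sub>R h x) = l - l'"
      using int by (simp_all add: mean_def ug vh scaleR_add_right scaleR_diff_right)
    ultimately show "\<exists>\<gamma> \<gamma>'. (\<gamma>, l + l') \<in> T \<and> (\<gamma>', l - l') \<in> T \<and> \<gamma> + \<gamma>' = 2 * \<beta> + 2 * \<beta>'"
      using inT[OF solutions_add[OF ug(1) vh(1)]] inT[OF minus]
      by (intro exI[of _ "energy (\<lambda>x. g x + h x)"] exI[of _ "energy (\<lambda>x. g x + (- 1) *\<^sub>R h x)"]) (simp only: simp_thms)
  next
    fix \<beta> and l q :: "real^'n" assume "(\<beta>, l) \<in> T"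
    then obtain u g where ug: "(u, g) \<in> solutions a U" "\<beta> = energy g" "l = mean g"
      by (auto simp: T_def)
    then show "- \<beta> + 2 * (q \<bullet> l) \<le> (norm q)\<^sup>2"
      using energy_mean_le by (auto simp: solutions_iff)
  next
    fix M :: "real^'n^'n"
    assume "transpose M = M"
      "\<And>q. (SUP (\<beta>, l)\<in>T. ereal (- \<beta> + 2 * (q \<bullet> l))) = ereal (q \<bullet> (M *v q))"
      "\<And>q. 0 \<le> q \<bullet> (M *v q)" "\<And>q. q \<bullet> (M *v q) \<le> (norm q)\<^sup>2"
    then show thesis by (rule that)
  qed
  have sup: "(SUP (u, g)\<in>solutions a U. ereal (avg U (\<lambda>x. - (g x \<bullet> (a x *v g x)) + 2 * (q \<bullet> g x))))
      = ereal (q \<bullet> (M *v q))" for q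
  proof -
    have "(SUP (u, g)\<in>solutions a U. ereal (avg U (\<lambda>x. - (g x \<bullet> (a x *v g x)) + 2 * (q \<bullet> g x))))
       = (SUP (u, g)\<in>solutions a U. ereal (- energy g + 2 * (q \<bullet> mean g)))"
    proof (intro SUP_cong refl)
      fix w assume "w \<in> solutions a U"
      then obtain u g where w: "w = (u, g)" "(u, g) \<in> H1 a U"
        by (cases w) (auto simp: solutions_iff)
      show "(case w of (u, g) \<Rightarrow> ereal (avg U (\<lambda>x. - (g x \<bullet> (a x *v g x)) + 2 * (q \<bullet> g x)))) =
        (case w of (u, g) \<Rightarrow> ereal (- energy g + 2 * (q \<bullet> mean g)))"
        by (simp only: w(1) prod.case avg_eq_energy_mean[OF w(2)])
    qed
    also have "\<dots> = (SUP (\<beta>, l)\<in>T. ereal (- \<beta> + 2 * (q \<bullet> l)))"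
      unfolding T_def image_image by (intro SUP_cong refl) auto
    finally show ?thesis
      unfolding M(2) .
  qed
  \<comment> \<open>The supremum is replaced by the form of M inside the description, which then
    asks for the symmetric matrix with the same form as M.\<close>
  have "a_star_inv a U = (THE N. transpose N = N \<and> (\<forall>q. ereal (q \<bullet> (N *v q)) = ereal (q \<bullet> (M *v q))))"
    unfolding a_star_inv_def sup ..
  also have "\<dots> = M"
  proof (rule the_equality)
    show "transpose M = M \<and> (\<forall>q. ereal (q \<bullet> (M *v q)) = ereal (q \<bullet> (M *v q)))"
      using M(1) by blast
    fix N :: "real^'n^'n" assume N: "transpose N = N \<and> (\<forall>q. ereal (q \<bullet> (N *v q)) = ereal (q \<bullet> (M *v q)))"
    then have "q \<bullet> (N *v q) = q \<bullet> (M *v q)" for q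
      by simp
    with N M(1) show "N = M"
      by (intro symmetric_matrix_eqI[of N M]) blast+
  qed
  finally show ?thesis
    using onorm_symmetric_matrix_le_1[OF M(1,3,4)] by (simp only:)
qed

lemma integrable_coefficient: "integrable L b"
proof (rule finite_measure.integrable_const_bound[OF finite_measure_L, of _ B])
  show "AE x in L. norm (b x) \<le> B"
    using one_le_b b_le by (intro AE_I2) (simp add: abs_le_iff order_trans[OF _ one_le_b])
qed measurable

text \<open>Completing the square bounds the integrand by \<open>p \<bullet> a p = b\<close>, whatever the cone is.\<close>

lemma cg_norm_le_avg: "cg_norm K a U \<le> ereal (avg U b)"
  unfolding cg_norm_def cg_coeff_def
proof (intro SUP_least, clarify)
  fix p :: "real^'n" and u g assume "p \<in> sphere 0 1" "(u, g) \<in> K a U"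
  then have p: "p \<bullet> p = 1"
    by (simp add: dot_square_norm)
  have pos: "0 \<le> b x" for x
    using one_le_b[of x] by linarith
  let ?f = "\<lambda>x. - (g x \<bullet> (a x *v g x)) + 2 * (p \<bullet> (a x *v g x))"
  have "?f x \<le> b x" for x
  proof -
    have "b x * 0 \<le> b x * ((p - g x) \<bullet> (p - g x))"
      by (intro mult_left_mono pos inner_ge_zero)
    then show ?thesis
      using p by (simp add: mat_mult_vector inner_diff inner_commute algebra_simps)
  qed
  then have "(\<integral>x. ?f x \<partial>L) \<le> (\<integral>x. b x \<partial>L)"
  proof (cases "integrable L ?f")
    case True
    then show ?thesis
      using \<open>\<And>x. ?f x \<le> b x\<close> by (intro integral_mono integrable_coefficient)
  next
    \<comment> \<open>In an arbitrary cone the integrand may fail to be integrable; its integral is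
      then 0 by convention, and b is nonnegative.\<close>
    case False
    show ?thesis
      unfolding not_integrable_integral_eq[OF False] by (intro Bochner_Integration.integral_nonneg pos)
  qed
  then show "ereal (avg U ?f) \<le> ereal (avg U b)"
    using U_pos by (simp add: avg_def divide_right_mono)
qed

end

section \<open>Mollified Ahlfors regular measures\<close>

lemma measure_cube: "measure lebesgue (cube k :: (real^'n) set) = (3 powi k) ^ CARD('n)"
proof -
  let ?l = "(\<chi> i. - (3 powi k / 2)) :: real^'n" and ?u = "(\<chi> i. 3 powi k / 2) :: real^'n"
  have "measure lebesgue (box ?l ?u) = measure lborel (cbox ?l ?u)"
    by (simp add: measure_completion measure_lborel_box_eq measure_lborel_cbox_eq)
  also have "\<dots> = (\<Prod>i\<in>UNIV. ?u $ i - ?l $ i)"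
  proof (rule content_cbox_cart)
    have "0 \<in> cbox ?l ?u"
      by (simp add: mem_box_cart)
    then show "cbox ?l ?u \<noteq> {}" by blast
  qed
  finally show ?thesis
    by (simp add: cube_def)
qed

lemma open_cube: "open (cube k)"
  by (simp add: cube_def open_box)

lemma bounded_cube: "bounded (cube k)"
  by (simp add: cube_def bounded_box)

lemma open_subcube: "open (subcube z k)"
  by (simp add: subcube_def open_translation open_cube)

lemma bounded_subcube: "bounded (subcube z k)"
  by (simp add: subcube_def bounded_translation bounded_cube)

lemma bounded_open_lmeasurable: "bounded S \<Longrightarrow> open S \<Longrightarrow> S \<in> lmeasurable" for S :: "'a::euclidean_space set"
  by (intro bounded_set_imp_lmeasurable) auto

lemma measure_subcube: "measure lebesgue (subcube z k :: (real^'n) set) = (3 powi k) ^ CARD('n)"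
  unfolding subcube_def by (simp only: measure_translation measure_cube)

lemma dist_subcube_le:
  fixes z :: "real^'n"
  assumes "x \<in> subcube z k"
  shows "dist z x \<le> real CARD('n) * 3 powi k"
proof -
  obtain w where w: "x = z + w" "w \<in> cube k"
    using assms by (auto simp: subcube_def)
  have "\<bar>w $ i\<bar> \<le> 3 powi k" for i
  proof -
    have "- (3 powi k / 2) < w $ i" "w $ i < 3 powi k / 2"
      using w(2) by (auto simp: cube_def mem_box_cart)
    then show ?thesis
      using zero_less_power_int[of "3::real" k] by linarith
  qed
  then have "norm w \<le> (\<Sum>(i::'n)\<in>UNIV. 3 powi k)"
    by (intro order_trans[OF norm_le_l1_cart] sum_mono)
  then show ?thesis
    by (simp add: w(1) dist_norm)
qed

lemma mollifier_bound:
  fixes \<eta> :: "real^'n \<Rightarrow> real"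
  assumes "mollifier \<eta>"
  obtains M where "0 \<le> M" "\<And>x. \<eta> x \<le> M"
proof -
  have "continuous_on UNIV \<eta>"
    using assms by (simp add: mollifier_def C_infinity_imp_continuous_on)
  then have "compact (\<eta> ` cball 0 1)"
    by (intro compact_continuous_image continuous_on_subset[OF \<open>continuous_on UNIV \<eta>\<close>]) auto
  then obtain M where M: "0 < M" "\<forall>y\<in>\<eta> ` cball 0 1. norm y \<le> M"
    using compact_imp_bounded bounded_pos by metis
  have "\<eta> x \<le> M" for x
  proof (cases "x \<in> cball 0 1")
    case False
    moreover have "{x. \<eta> x \<noteq> 0} \<subseteq> cball 0 1"
      using assms closure_subset[of "{x. \<eta> x \<noteq> 0}"] by (auto simp: mollifier_def supp_def)
    ultimately have "\<eta> x = 0" by auto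
    then show ?thesis using M(1) by simp
  next
    case True
    then have "norm (\<eta> x) \<le> M" using M(2) by blast
    then show ?thesis by simp
  qed
  then show ?thesis
    using M(1) by (intro that[of M]) auto
qed

lemma ennsqrt_e2ennreal_le:
  assumes "x \<le> ereal v" "0 \<le> v"
  shows "ennsqrt (e2ennreal x) \<le> ennreal (sqrt v)"
proof -
  have le: "e2ennreal x \<le> ennreal v"
    using e2ennreal_mono[OF assms(1)] by simp
  then have "e2ennreal x \<noteq> \<infinity>"
    by (metis ennreal_neq_top infinity_ennreal_def neq_top_trans)
  moreover have "enn2real (e2ennreal x) \<le> v"
    using le assms(2) by (rule enn2real_leI[rotated])
  ultimately show ?thesis
    by (simp add: ennsqrt_def ennreal_leI)
qed

locale ahlfors_mollification =
  fixes \<alpha> C\<^sub>0 :: real and \<eta> :: "real^'n \<Rightarrow> real" and F :: "(real^'n) set" and \<mu> :: "(real^'n) measure"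
  assumes mollifier: "mollifier \<eta>" and compact_F: "compact F" and F_cube: "F \<subseteq> cube 0"
    and ahlfors: "ahlfors_regular \<alpha> C\<^sub>0 F \<mu>" and \<alpha>_pos: "0 < \<alpha>" and C\<^sub>0: "1 \<le> C\<^sub>0"
begin

sublocale \<mu>: prob_space \<mu>
  using ahlfors by (simp add: ahlfors_regular_def)

lemma sets_\<mu> [measurable_cong]: "sets \<mu> = sets borel"
  using ahlfors by (simp add: ahlfors_regular_def)

lemma space_\<mu> [simp]: "space \<mu> = UNIV"
  using sets_eq_imp_space_eq[OF sets_\<mu>] by simp

lemma AE_F: "AE y in \<mu>. y \<in> F"
  using ahlfors by (intro \<mu>.AE_prob_1) (simp add: ahlfors_regular_def)

lemma F_nonempty: "F \<noteq> {}"
  using ahlfors by (auto simp: ahlfors_regular_def)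

lemma measure_cube_0: "measure \<mu> (cube 0) = 1"
proof -
  have "cube 0 \<in> sets \<mu>"
    by (simp add: sets_\<mu> open_cube)
  then show ?thesis
    using AE_F F_cube by (subst \<mu>.AE_in_set_eq_1[symmetric]) auto
qed

lemma eta_nonneg: "0 \<le> \<eta> x"
  and eta_borel [measurable]: "\<eta> \<in> borel_measurable borel"
  using mollifier
  by (auto simp: mollifier_def intro!: borel_measurable_continuous_onI C_infinity_imp_continuous_on)

lemma eta_eq_0: "1 < norm x \<Longrightarrow> \<eta> x = 0"
  using mollifier closure_subset[of "{x. \<eta> x \<noteq> 0}"] by (force simp: mollifier_def supp_def)

text \<open>The choice involves \<open>\<eta>\<close> alone. Constants built from it are thus the
  same for all F and all measures.\<close>

definition eta_bound :: real where
  "eta_bound = (SOME M. 0 \<le> M \<and> (\<forall>x. \<eta> x \<le> M))"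

lemma eta_bound: "0 \<le> eta_bound" "\<eta> x \<le> eta_bound"
proof -
  have "\<exists>M. 0 \<le> M \<and> (\<forall>x. \<eta> x \<le> M)"
    using mollifier_bound[OF mollifier] by metis
  from someI_ex[OF this] show "0 \<le> eta_bound" "\<eta> x \<le> eta_bound"
    unfolding eta_bound_def by auto
qed

text \<open>Ahlfors regularity speaks of centres in F and radii below 1 only. A ball that meets F at
  y lies in \<open>ball y (3 * r)\<close>, where 3 instead of 2 leaves room for an open ball; for 3
  r >= 1 the right-hand side is at least 1 because \<open>C\<^sub>0\<close> is.\<close>

lemma measure_cball_le:
  assumes "0 < r"
  shows "measure \<mu> (cball x r) \<le> C\<^sub>0 * (3 * r) powr \<alpha>"
proof (cases "cball x r \<inter> F = {}")
  case True
  then have "AE y in \<mu>. y \<notin> cball x r"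
    by (intro eventually_mono[OF AE_F]) (use True in blast)
  then have "measure \<mu> (cball x r) = 0"
    by (subst \<mu>.prob_eq_0) (auto simp: sets_\<mu>)
  then show ?thesis
    using C\<^sub>0 by simp
next
  case False
  then obtain y where y: "dist x y \<le> r" "y \<in> F" by auto
  show ?thesis
  proof (cases "3 * r < 1")
    case True
    have "cball x r \<subseteq> ball y (3 * r)"
    proof
      fix w assume "w \<in> cball x r"
      then show "w \<in> ball y (3 * r)"
        using y(1) dist_triangle[of y w x] assms by (simp add: dist_commute)
    qed
    then have "measure \<mu> (cball x r) \<le> measure \<mu> (ball y (3 * r))"
      by (intro \<mu>.finite_measure_mono) (auto simp: sets_\<mu>)
    also have "\<dots> \<le> C\<^sub>0 * (3 * r) powr \<alpha>"
      using ahlfors y(2) True assms by (auto simp: ahlfors_regular_def)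
    finally show ?thesis .
  next
    case False
    then have "1 \<le> (3 * r) powr \<alpha>"
      using \<alpha>_pos by (intro ge_one_powr_ge_zero) auto
    then have "1 \<le> C\<^sub>0 * (3 * r) powr \<alpha>"
      using C\<^sub>0 mult_mono[of 1 C\<^sub>0 1 "(3 * r) powr \<alpha>"] by simp
    then show ?thesis
      by (rule order_trans[OF \<mu>.prob_le_1])
  qed
qed

section \<open>The rescaled kernel and the mollified measure\<close>

definition kernel :: "real \<Rightarrow> real^'n \<Rightarrow> real^'n \<Rightarrow> real" where
  "kernel \<delta> x y = \<eta> ((x - y) /\<^sub>R \<delta>) / \<delta> ^ CARD('n)"

lemma kernel_measurable [measurable]:
  "(\<lambda>(x, y). kernel \<delta> x y) \<in> borel_measurable (borel \<Otimes>\<^sub>M borel)"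
  unfolding kernel_def by measurable

lemma kernel_nonneg: "0 < \<delta> \<Longrightarrow> 0 \<le> kernel \<delta> x y"
  by (simp add: kernel_def eta_nonneg)

lemma kernel_le: "0 < \<delta> \<Longrightarrow> kernel \<delta> x y \<le> eta_bound / \<delta> ^ CARD('n)"
  by (simp add: kernel_def eta_bound divide_right_mono)

lemma kernel_eq_0: "0 < \<delta> \<Longrightarrow> \<delta> < dist x y \<Longrightarrow> kernel \<delta> x y = 0"
  unfolding kernel_def by (subst eta_eq_0) (simp_all add: dist_norm divide_inverse_commute[symmetric] less_divide_eq)

lemma nn_integral_kernel:
  assumes "0 < \<delta>"
  shows "(\<integral>\<^sup>+x. ennreal (kernel \<delta> x y) \<partial>lborel) = 1"
proof -
  have \<eta>1: "(\<integral>x. \<eta> x \<partial>lebesgue) = 1"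
    using mollifier by (simp add: mollifier_def)
  \<comment> \<open>An integral different from the default value 0 forces integrability.\<close>
  then have "integrable lebesgue \<eta>"
    using not_integrable_integral_eq by fastforce
  then have "(\<integral>\<^sup>+x. ennreal (\<eta> x) \<partial>lebesgue) = 1"
    using \<eta>1 by (simp add: nn_integral_eq_integral eta_nonneg)
  then have one: "(\<integral>\<^sup>+x. ennreal (\<eta> x) \<partial>lborel) = 1"
    by (simp add: nn_integral_completion)
  \<comment> \<open>Substituting y + \<delta> x produces the Jacobian \<delta>^d, which cancels the
    normalisation of the kernel.\<close>
  have "(\<integral>\<^sup>+x. ennreal (kernel \<delta> x y) \<partial>lborel)
      = (\<integral>\<^sup>+x. ennreal (kernel \<delta> x y) \<partial>density (distr lborel borel (\<lambda>x. y + \<delta> *\<^sub>R x)) (\<lambda>_. ennreal (\<bar>\<delta>\<bar> ^ DIM(real^'n))))"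
    using assms by (subst lborel_affine[of \<delta> y]) auto
  also have "\<dots> = (\<integral>\<^sup>+x. ennreal (\<delta> ^ CARD('n)) * ennreal (kernel \<delta> (y + \<delta> *\<^sub>R x) y) \<partial>lborel)"
    using assms by (simp add: nn_integral_density nn_integral_distr)
  also have "\<dots> = (\<integral>\<^sup>+x. ennreal (\<eta> x) \<partial>lborel)"
    using assms by (intro nn_integral_cong) (simp add: kernel_def eta_nonneg flip: ennreal_mult)
  finally show ?thesis
    using one by simp
qed

abbreviation "f \<equiv> mollified_measure \<eta> \<mu>"

text \<open>The measure lives on F, which lies in the unit cube, so it does not see the restriction
  to that cube.\<close>

lemma f_eq: "f \<delta> x = (\<integral>y. kernel \<delta> x y \<partial>\<mu>)"
  unfolding mollified_measure_def set_lebesgue_integral_def kernel_def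
proof (rule integral_cong_AE)
  show "AE y in \<mu>. indicat_real (cube 0) y *\<^sub>R (\<eta> ((x - y) /\<^sub>R \<delta>) / \<delta> ^ CARD('n)) = \<eta> ((x - y) /\<^sub>R \<delta>) / \<delta> ^ CARD('n)"
    by (intro eventually_mono[OF AE_F]) (use F_cube in auto)
  have [measurable]: "cube 0 \<in> sets borel"
    by (simp add: open_cube)
  show "(\<lambda>y. indicat_real (cube 0) y *\<^sub>R (\<eta> ((x - y) /\<^sub>R \<delta>) / \<delta> ^ CARD('n))) \<in> borel_measurable \<mu>"
    by measurable
qed measurable

lemma kernel_measurable_snd [measurable]: "kernel \<delta> x \<in> borel_measurable \<mu>"
  unfolding kernel_def[abs_def] by measurable

lemma integrable_kernel: "0 < \<delta> \<Longrightarrow> integrable \<mu> (kernel \<delta> x)"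
  by (intro \<mu>.integrable_const_bound[of _ "eta_bound / \<delta> ^ CARD('n)"] AE_I2)
    (auto simp: kernel_nonneg kernel_le)

lemma f_measurable [measurable]: "f \<delta> \<in> borel_measurable borel"
proof -
  have "(\<lambda>(x, y). kernel \<delta> x y) \<in> borel_measurable (borel \<Otimes>\<^sub>M \<mu>)"
    using kernel_measurable measurable_cong_sets[OF sets_pair_measure_cong[OF refl sets_\<mu>] refl] by blast
  then show ?thesis
    unfolding f_eq[abs_def] by (rule \<mu>.borel_measurable_lebesgue_integral)
qed

lemma f_nonneg: "0 < \<delta> \<Longrightarrow> 0 \<le> f \<delta> x"
  unfolding f_eq by (intro Bochner_Integration.integral_nonneg kernel_nonneg)

lemma f_le:
  assumes "0 < \<delta>"
  shows "f \<delta> x \<le> eta_bound / \<delta> ^ CARD('n) * measure \<mu> (cball x \<delta>)"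
proof -
  have "f \<delta> x \<le> (\<integral>y. eta_bound / \<delta> ^ CARD('n) * indicat_real (cball x \<delta>) y \<partial>\<mu>)"
    unfolding f_eq using assms eta_bound(1)
    by (intro integral_mono integrable_kernel integrable_mult_right integrable_real_indicator)
      (auto simp: kernel_le kernel_eq_0 indicator_def sets_\<mu> \<mu>.emeasure_eq_measure)
  then show ?thesis
    by (simp add: sets_\<mu>)
qed

lemma f_le_const: "0 < \<delta> \<Longrightarrow> f \<delta> x \<le> eta_bound / \<delta> ^ CARD('n)"
  using f_le[of \<delta> x] mult_left_mono[OF \<mu>.prob_le_1, of "eta_bound / \<delta> ^ CARD('n)" "cball x \<delta>"] eta_bound(1)
  by simp

lemma f_eq_0:
  assumes "0 < \<delta>" "\<And>y. y \<in> F \<Longrightarrow> \<delta> < dist x y"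
  shows "f \<delta> x = 0"
proof -
  have "f \<delta> x = (\<integral>y. 0 \<partial>\<mu>)"
    unfolding f_eq using AE_F assms by (intro integral_cong_AE) (auto elim!: eventually_mono simp: kernel_eq_0)
  then show ?thesis by simp
qed

section \<open>Mass of the mollified measure by Tonelli's theorem\<close>

lemma nn_integral_f:
  assumes "0 < \<delta>" and [measurable]: "U \<in> sets borel"
  shows "(\<integral>\<^sup>+x. ennreal (f \<delta> x) \<partial>lebesgue_on U)
    = (\<integral>\<^sup>+y. (\<integral>\<^sup>+x. ennreal (kernel \<delta> x y) * indicator U x \<partial>lborel) \<partial>\<mu>)"
proof -
  interpret pair_sigma_finite lborel \<mu> ..
  have [measurable]: "(\<lambda>(x, y). kernel \<delta> x y) \<in> borel_measurable (lborel \<Otimes>\<^sub>M \<mu>)"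
    using kernel_measurable measurable_cong_sets[OF sets_pair_measure_cong[OF sets_lborel[symmetric] sets_\<mu>[symmetric]] refl] by blast
  have "(\<integral>\<^sup>+x. ennreal (f \<delta> x) \<partial>lebesgue_on U) = (\<integral>\<^sup>+x. ennreal (f \<delta> x) * indicator U x \<partial>lborel)"
    by (simp add: nn_integral_restrict_space nn_integral_completion)
  also have "\<dots> = (\<integral>\<^sup>+x. (\<integral>\<^sup>+y. ennreal (kernel \<delta> x y) * indicator U x \<partial>\<mu>) \<partial>lborel)"
    using assms(1)
    by (intro nn_integral_cong)
      (simp add: f_eq nn_integral_eq_integral integrable_kernel kernel_nonneg nn_integral_multc)
  also have "\<dots> = (\<integral>\<^sup>+y. (\<integral>\<^sup>+x. ennreal (kernel \<delta> x y) * indicator U x \<partial>lborel) \<partial>\<mu>)"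
    by (rule Fubini'[symmetric]) measurable
  finally show ?thesis .
qed

text \<open>Each y contributes the part of its kernel that lies in U: at most 1, and nothing if y is
  farther than \<open>\<delta>\<close> from all points of U.\<close>

lemma nn_integral_f_le:
  assumes "0 < \<delta>" "U \<in> sets borel" and [measurable]: "V \<in> sets borel"
    and V: "\<And>x y. x \<in> U \<Longrightarrow> dist x y \<le> \<delta> \<Longrightarrow> y \<in> V"
  shows "(\<integral>\<^sup>+x. ennreal (f \<delta> x) \<partial>lebesgue_on U) \<le> ennreal (measure \<mu> V)"
proof -
  have "(\<integral>\<^sup>+x. ennreal (kernel \<delta> x y) * indicator U x \<partial>lborel) \<le> indicator V y" for y
  proof (cases "y \<in> V")
    case True
    have "(\<integral>\<^sup>+x. ennreal (kernel \<delta> x y) * indicator U x \<partial>lborel) \<le> (\<integral>\<^sup>+x. ennreal (kernel \<delta> x y) \<partial>lborel)"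
      by (intro nn_integral_mono) (auto simp: indicator_def)
    then show ?thesis
      using True nn_integral_kernel[OF assms(1)] by simp
  next
    case False
    then have "ennreal (kernel \<delta> x y) * indicator U x = 0" for x
      using V[of x y] kernel_eq_0[OF assms(1), of x y] by (cases "dist x y \<le> \<delta>") (auto simp: indicator_def)
    then have "(\<integral>\<^sup>+x. ennreal (kernel \<delta> x y) * indicator U x \<partial>lborel) = (\<integral>\<^sup>+x. 0 \<partial>(lborel :: (real^'n) measure))"
      by (intro nn_integral_cong)
    then show ?thesis
      by simp
  qed
  then have "(\<integral>\<^sup>+x. ennreal (f \<delta> x) \<partial>lebesgue_on U) \<le> (\<integral>\<^sup>+y. indicator V y \<partial>\<mu>)"
    unfolding nn_integral_f[OF assms(1,2)] by (intro nn_integral_mono)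
  then show ?thesis
    by (simp add: sets_\<mu> \<mu>.emeasure_eq_measure)
qed

text \<open>The opposite extreme: for almost every y the whole kernel lies in U, so no mass is
  lost.\<close>

lemma nn_integral_f_eq_1:
  assumes "0 < \<delta>" "U \<in> sets borel"
    and U: "\<And>x y. y \<in> F \<Longrightarrow> dist x y \<le> \<delta> \<Longrightarrow> x \<in> U"
  shows "(\<integral>\<^sup>+x. ennreal (f \<delta> x) \<partial>lebesgue_on U) = 1"
proof -
  have "(\<integral>\<^sup>+x. ennreal (kernel \<delta> x y) * indicator U x \<partial>lborel) = 1" if "y \<in> F" for y
  proof -
    have "ennreal (kernel \<delta> x y) * indicator U x = ennreal (kernel \<delta> x y)" for x
      using U[OF that, of x] kernel_eq_0[OF assms(1), of x y] by (cases "dist x y \<le> \<delta>") auto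
    then show ?thesis
      using nn_integral_kernel[OF assms(1)] by simp
  qed
  then have "(\<integral>\<^sup>+x. ennreal (f \<delta> x) \<partial>lebesgue_on U) = (\<integral>\<^sup>+y. 1 \<partial>\<mu>)"
    unfolding nn_integral_f[OF assms(1,2)] using AE_F by (intro nn_integral_cong_AE) (auto elim!: eventually_mono)
  then show ?thesis
    by (simp add: \<mu>.emeasure_space_1[unfolded space_\<mu>])
qed

lemma f_measurable_lebesgue_on [measurable]: "f \<delta> \<in> borel_measurable (lebesgue_on U)"
  by (intro measurable_restrict_space1 measurable_completion) simp

lemma integrable_f:
  assumes "0 < \<delta>" "U \<in> lmeasurable"
  shows "integrable (lebesgue_on U) (f \<delta>)"
proof (rule finite_measure.integrable_const_bound[OF finite_measure_lebesgue_on[OF assms(2)]])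
  show "AE x in lebesgue_on U. norm (f \<delta> x) \<le> eta_bound / \<delta> ^ CARD('n)"
    using assms(1) by (intro AE_I2) (simp add: f_nonneg f_le_const)
qed measurable

lemma ennreal_integral_f:
  assumes "0 < \<delta>" "U \<in> lmeasurable"
  shows "ennreal (\<integral>x. f \<delta> x \<partial>lebesgue_on U) = (\<integral>\<^sup>+x. ennreal (f \<delta> x) \<partial>lebesgue_on U)"
  using assms by (intro nn_integral_eq_integral[symmetric] integrable_f AE_I2 f_nonneg)

lemma integral_a_delta:
  assumes "0 < \<delta>" "U \<in> lmeasurable"
  shows "integrable (lebesgue_on U) (a_delta \<eta> \<mu> \<delta>)"
    and "(\<integral>x. a_delta \<eta> \<mu> \<delta> x \<partial>lebesgue_on U) = measure lebesgue U + (\<integral>x. f \<delta> x \<partial>lebesgue_on U)"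
proof -
  have one: "integrable (lebesgue_on U) (\<lambda>x. 1 :: real)"
    by (intro finite_measure.integrable_const finite_measure_lebesgue_on assms)
  have m: "measure (lebesgue_on U) (space (lebesgue_on U)) = measure lebesgue U"
    using assms(2) by (simp add: measure_restrict_space fmeasurableD)
  show "integrable (lebesgue_on U) (a_delta \<eta> \<mu> \<delta>)"
    unfolding a_delta_def[abs_def] by (intro Bochner_Integration.integrable_add one integrable_f assms)
  show "(\<integral>x. a_delta \<eta> \<mu> \<delta> x \<partial>lebesgue_on U) = measure lebesgue U + (\<integral>x. f \<delta> x \<partial>lebesgue_on U)"
    unfolding a_delta_def using m
    by (subst Bochner_Integration.integral_add[OF one integrable_f[OF assms]]) simp
qed

section \<open>Averages over triadic cubes and coarse-grained ellipticity\<close>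

lemma bounded_scalar_field_a_delta:
  assumes "0 < \<delta>"
  shows "bounded_scalar_field (a_delta \<eta> \<mu> \<delta>) (subcube z k) (1 + eta_bound / \<delta> ^ CARD('n))"
proof
  show "a_delta \<eta> \<mu> \<delta> \<in> borel_measurable borel"
    unfolding a_delta_def[abs_def] by measurable
  show "1 \<le> a_delta \<eta> \<mu> \<delta> x" "a_delta \<eta> \<mu> \<delta> x \<le> 1 + eta_bound / \<delta> ^ CARD('n)" for x
    using f_nonneg[OF assms] f_le_const[OF assms] by (simp_all add: a_delta_def)
qed (simp_all add: bounded_subcube bounded_open_lmeasurable open_subcube measure_subcube)

text \<open>The summands are the constants for \<open>\<delta>\<close> above and below the side
  length h of the cube; the sum serves both cases. In 3 (d + 1), the 3 stems from
  \<open>measure_cball_le\<close>, d h bounds the distance from the centre to points of the cube,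
  and a further h absorbs \<open>\<delta>\<close>.\<close>

definition density_const :: real where
  "density_const = eta_bound * C\<^sub>0 * 3 powr \<alpha> + C\<^sub>0 * (3 * (real CARD('n) + 1)) powr \<alpha>"

lemma density_const_nonneg: "0 \<le> density_const"
  using C\<^sub>0 eta_bound(1) by (simp add: density_const_def)

text \<open>If \<open>\<delta> \<le> 3\<^sup>k\<close>, the integral is at most the \<open>\<mu>\<close>-mass of a ball of radius comparable to \<open>3\<^sup>k\<close>;
  otherwise the pointwise bound \<open>\<mu>\<^sup>\<delta> \<lesssim> \<delta>\<^bsup>\<alpha>-d\<^esup>\<close> suffices.\<close>

lemma integral_f_subcube_le:
  assumes "0 < \<delta>" "\<alpha> < real CARD('n)"
  shows "(\<integral>x. f \<delta> x \<partial>lebesgue_on (subcube z k)) \<le> density_const * (3 powi k) powr \<alpha>"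
proof -
  define n h where "n = CARD('n)" and "h = (3::real) powi k"
  have h: "0 < h"
    by (simp add: h_def)
  have hn: "h ^ n = h powr real n" and \<delta>n: "\<delta> ^ n = \<delta> powr real n"
    using h assms(1) by (simp_all add: powr_realpow)
  have U: "subcube z k \<in> lmeasurable"
    by (intro bounded_open_lmeasurable bounded_subcube open_subcube)
  have mU: "measure lebesgue (subcube z k) = h ^ n"
    by (simp add: measure_subcube h_def n_def)
  have parts: "0 \<le> eta_bound * C\<^sub>0 * 3 powr \<alpha> * h powr \<alpha>" "0 \<le> C\<^sub>0 * (3 * (real n + 1)) powr \<alpha> * h powr \<alpha>"
    using C\<^sub>0 eta_bound(1) by simp_all
  show ?thesis
  proof (cases "\<delta> \<le> h")
    case True
    let ?V = "cball z ((real n + 1) * h)"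
    have "y \<in> ?V" if "x \<in> subcube z k" "dist x y \<le> \<delta>" for x y
      using dist_triangle[of z y x] dist_subcube_le[OF that(1)] that(2) True
      by (simp add: n_def h_def algebra_simps)
    then have "(\<integral>\<^sup>+x. ennreal (f \<delta> x) \<partial>lebesgue_on (subcube z k)) \<le> ennreal (measure \<mu> ?V)"
      by (intro nn_integral_f_le assms(1)) (simp_all add: open_subcube)
    then have "(\<integral>x. f \<delta> x \<partial>lebesgue_on (subcube z k)) \<le> measure \<mu> ?V"
      by (simp flip: ennreal_integral_f[OF assms(1) U])
    also have "\<dots> \<le> C\<^sub>0 * (3 * ((real n + 1) * h)) powr \<alpha>"
      using h by (intro measure_cball_le) simp
    also have "\<dots> = C\<^sub>0 * (3 * (real n + 1)) powr \<alpha> * h powr \<alpha>"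
      using h by (simp add: powr_mult mult.assoc[symmetric])
    also have "\<dots> \<le> density_const * h powr \<alpha>"
      using parts by (simp add: density_const_def distrib_right n_def)
    finally show ?thesis
      by (simp add: h_def)
  next
    case False
    have "f \<delta> x \<le> eta_bound * C\<^sub>0 * 3 powr \<alpha> * h powr (\<alpha> - real n)" for x
    proof -
      have "f \<delta> x \<le> eta_bound / \<delta> ^ n * measure \<mu> (cball x \<delta>)"
        using f_le[OF assms(1)] by (simp add: n_def)
      also have "\<dots> \<le> eta_bound / \<delta> ^ n * (C\<^sub>0 * (3 * \<delta>) powr \<alpha>)"
        using eta_bound(1) assms(1) by (intro mult_left_mono measure_cball_le) simp_all
      also have "\<dots> = eta_bound * C\<^sub>0 * 3 powr \<alpha> * \<delta> powr (\<alpha> - real n)"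
        using assms(1) by (simp add: powr_mult powr_diff \<delta>n)
      \<comment> \<open>The exponent is negative and h < \<delta>, so passing from
        \<open>\<delta>\<close> to h removes the dependence on \<open>\<delta>\<close>.\<close>
      also have "\<dots> \<le> eta_bound * C\<^sub>0 * 3 powr \<alpha> * h powr (\<alpha> - real n)"
        using eta_bound(1) C\<^sub>0 False h assms(2) by (intro mult_left_mono powr_mono2') (simp_all add: n_def)
      finally show ?thesis .
    qed
    then have "(\<integral>x. f \<delta> x \<partial>lebesgue_on (subcube z k))
        \<le> (\<integral>x. eta_bound * C\<^sub>0 * 3 powr \<alpha> * h powr (\<alpha> - real n) \<partial>lebesgue_on (subcube z k))"
      using assms(1) U
      by (intro integral_mono integrable_f finite_measure.integrable_const finite_measure_lebesgue_on)
    also have "\<dots> = eta_bound * C\<^sub>0 * 3 powr \<alpha> * h powr (\<alpha> - real n) * h ^ n"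
      using U mU by (simp add: measure_restrict_space fmeasurableD)
    also have "\<dots> = eta_bound * C\<^sub>0 * 3 powr \<alpha> * h powr \<alpha>"
      using h by (simp add: powr_diff hn)
    also have "\<dots> \<le> density_const * h powr \<alpha>"
      using parts by (simp add: density_const_def distrib_right n_def)
    finally show ?thesis
      by (simp add: h_def)
  qed
qed

lemma avg_a_delta_le:
  assumes "0 < \<delta>" "\<alpha> < real CARD('n)" "k \<le> 0"
  shows "avg (subcube z k) (a_delta \<eta> \<mu> \<delta>) \<le> (1 + density_const) * (3 powi k) powr (\<alpha> - real CARD('n))"
proof -
  define h where "h = (3::real) powi k"
  have h: "0 < h" "h \<le> 1"
    using assms(3) powr_le_cancel_iff[of 3 "of_int k" 0] by (simp_all add: h_def powr_real_of_int')
  have hn: "h ^ CARD('n) = h powr real CARD('n)"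
    using h by (simp add: powr_realpow)
  have "avg (subcube z k) (a_delta \<eta> \<mu> \<delta>) = 1 + (\<integral>x. f \<delta> x \<partial>lebesgue_on (subcube z k)) / h ^ CARD('n)"
    using h(1) unfolding avg_def
    by (subst integral_a_delta(2)[OF assms(1) bounded_open_lmeasurable[OF bounded_subcube open_subcube]])
      (simp add: measure_subcube h_def add_divide_distrib)
  also have "\<dots> \<le> 1 + density_const * h powr \<alpha> / h ^ CARD('n)"
    using integral_f_subcube_le[OF assms(1,2), of z k] h(1)
    by (intro add_left_mono divide_right_mono) (simp_all add: h_def)
  also have "\<dots> = 1 + density_const * h powr (\<alpha> - real CARD('n))"
    by (simp add: powr_diff hn)
  \<comment> \<open>Since h <= 1 and the exponent is negative, the power is at least 1 and absorbs
    the background value 1 of the field.\<close>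
  also have "\<dots> \<le> (1 + density_const) * h powr (\<alpha> - real CARD('n))"
    using powr_mono2'[of "\<alpha> - real CARD('n)" h 1] h assms(2) by (simp add: distrib_right)
  finally show ?thesis
    by (simp add: h_def)
qed

text \<open>The denominator is that of a geometric series whose ratio is below 1 exactly when 2s > d
  - \<alpha>; the outer square is the one in \<open>Lambda_s\<close>.\<close>

definition Lambda_const :: "real \<Rightarrow> real" where
  "Lambda_const s = (c_s s * (sqrt (1 + density_const) / (1 - 3 powr ((real CARD('n) - \<alpha>) / 2 - s))))\<^sup>2"

lemma Lambda_s_le:
  assumes "0 < \<delta>" "\<alpha> < real CARD('n)" "0 < s" "real CARD('n) - \<alpha> < 2 * s"
  shows "Lambda_s s 0 K (\<lambda>x. mat (a_delta \<eta> \<mu> \<delta> x)) \<le> ennreal (Lambda_const s)"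
proof -
  define A where "A = 1 + density_const"
  define q where "q = 3 powr ((real CARD('n) - \<alpha>) / 2 - s)"
  have A: "0 \<le> A"
    using density_const_nonneg by (simp add: A_def)
  have q: "0 \<le> q" "q < 1"
    using assms(4) powr_less_cancel_iff[of 3 "(real CARD('n) - \<alpha>) / 2 - s" 0] by (simp_all add: q_def)
  have c: "0 \<le> c_s s"
    using assms(3) powr_le_cancel_iff[of 3 "- s" 0] by (simp add: c_s_def)
  have "ennreal (3 powr (- s * of_int (0 - k))) *
      (SUP z\<in>lattice k \<inter> cube 0. ennsqrt (e2ennreal (cg_norm K (\<lambda>x. mat (a_delta \<eta> \<mu> \<delta> x)) (subcube z k))))
      \<le> ennreal (sqrt A * q ^ nat (- k))" if k: "k \<le> 0" for k :: int
  proof -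
    define v where "v = A * (3 powi k) powr (\<alpha> - real CARD('n))"
    have v: "0 \<le> v"
      using A by (simp add: v_def)
    have "cg_norm K (\<lambda>x. mat (a_delta \<eta> \<mu> \<delta> x)) (subcube z k) \<le> ereal v" for z
    proof -
      interpret bounded_scalar_field "a_delta \<eta> \<mu> \<delta>" "subcube z k" "1 + eta_bound / \<delta> ^ CARD('n)"
        by (rule bounded_scalar_field_a_delta) (rule assms)
      show ?thesis
        using avg_a_delta_le[OF assms(1,2) k, of z]
        by (intro order_trans[OF cg_norm_le_avg]) (simp add: v_def A_def)
    qed
    then have "(SUP z\<in>lattice k \<inter> cube 0. ennsqrt (e2ennreal (cg_norm K (\<lambda>x. mat (a_delta \<eta> \<mu> \<delta> x)) (subcube z k))))
        \<le> ennreal (sqrt v)"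
      using v by (intro SUP_least ennsqrt_e2ennreal_le)
    then have "ennreal (3 powr (- s * of_int (0 - k))) *
        (SUP z\<in>lattice k \<inter> cube 0. ennsqrt (e2ennreal (cg_norm K (\<lambda>x. mat (a_delta \<eta> \<mu> \<delta> x)) (subcube z k))))
        \<le> ennreal (3 powr (- s * of_int (0 - k))) * ennreal (sqrt v)"
      by (rule mult_left_mono) simp
    also have "\<dots> = ennreal (3 powr (- s * of_int (0 - k)) * sqrt v)"
      using v by (simp add: ennreal_mult)
    \<comment> \<open>The weight contributes the exponent s k and the root of the average k
      (\<alpha> - d)/2. Together they give the power -k of q.\<close>
    also have "3 powr (- s * of_int (0 - k)) * sqrt v = sqrt A * q ^ nat (- k)"
    proof -
      have "(3 powi k) powr (\<alpha> - real CARD('n)) = 3 powr (of_int k * (\<alpha> - real CARD('n)))"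
        by (simp add: powr_powr flip: powr_real_of_int')
      then have "sqrt v = sqrt A * 3 powr (of_int k * (\<alpha> - real CARD('n)) / 2)"
        by (simp add: v_def real_sqrt_mult powr_half_sqrt[symmetric] powr_powr)
      moreover have "q ^ nat (- k) = 3 powr (((real CARD('n) - \<alpha>) / 2 - s) * of_int (- k))"
      proof -
        have "q ^ nat (- k) = q powr real (nat (- k))"
          by (simp add: q_def powr_realpow)
        then show ?thesis
          using k by (simp add: q_def powr_powr)
      qed
      moreover have "- s * of_int (0 - k) + of_int k * (\<alpha> - real CARD('n)) / 2
          = ((real CARD('n) - \<alpha>) / 2 - s) * of_int (- k)"
        by (simp add: field_simps)
      ultimately show ?thesis
        by (simp only: mult.left_commute[of _ "sqrt A"] powr_add[symmetric])
    qed
    finally show ?thesis .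
  qed
  then have "(\<Sum>\<^sub>\<infinity>k\<in>{..0}. ennreal (3 powr (- s * of_int (0 - k))) *
      (SUP z\<in>lattice k \<inter> cube 0. ennsqrt (e2ennreal (cg_norm K (\<lambda>x. mat (a_delta \<eta> \<mu> \<delta> x)) (subcube z k)))))
      \<le> ennreal (sqrt A / (1 - q))"
    using q A by (intro infsum_ennreal_geometric_le) simp_all
  then have "Lambda_s s 0 K (\<lambda>x. mat (a_delta \<eta> \<mu> \<delta> x)) \<le> (ennreal (c_s s) * ennreal (sqrt A / (1 - q)))\<^sup>2"
    unfolding Lambda_s_def by (intro power_mono mult_left_mono) simp_all
  also have "\<dots> = ennreal (Lambda_const s)"
    using c A q unfolding Lambda_const_def A_def[symmetric] q_def[symmetric]
    by (simp add: ennreal_mult[symmetric] ennreal_power)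
  finally show ?thesis .
qed

lemma Theta_s_t_le_Lambda_s:
  assumes "0 < \<delta>" "0 < t"
  shows "Theta_s_t s t 0 K (\<lambda>x. mat (a_delta \<eta> \<mu> \<delta> x)) \<le> Lambda_s s 0 K (\<lambda>x. mat (a_delta \<eta> \<mu> \<delta> x))"
proof -
  let ?a = "\<lambda>x. mat (a_delta \<eta> \<mu> \<delta> x) :: real^'n^'n"
  define q where "q = 3 powr (- t)"
  have q: "0 \<le> q" "q < 1"
    using assms(2) powr_less_cancel_iff[of 3 "- t" 0] by (simp_all add: q_def)
  define X where "X = ennreal (c_s t) * (\<Sum>\<^sub>\<infinity>k\<in>{..0}. ennreal (3 powr (- t * of_int (0 - k))) *
      (SUP z\<in>lattice k \<inter> cube 0. ennreal (sqrt (onorm ((*v) (a_star_inv ?a (subcube z k)))))))"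
  have "ennreal (3 powr (- t * of_int (0 - k))) *
      (SUP z\<in>lattice k \<inter> cube 0. ennreal (sqrt (onorm ((*v) (a_star_inv ?a (subcube z k))))))
      \<le> ennreal (1 * q ^ nat (- k))" if k: "k \<le> 0" for k :: int
  proof -
    have "onorm ((*v) (a_star_inv ?a (subcube z k))) \<le> 1" for z
    proof -
      interpret bounded_scalar_field "a_delta \<eta> \<mu> \<delta>" "subcube z k" "1 + eta_bound / \<delta> ^ CARD('n)"
        by (rule bounded_scalar_field_a_delta) (rule assms)
      show ?thesis
        by (rule onorm_a_star_inv_le_1)
    qed
    then have "(SUP z\<in>lattice k \<inter> cube 0. ennreal (sqrt (onorm ((*v) (a_star_inv ?a (subcube z k)))))) \<le> 1"
      by (intro SUP_least) (simp add: ennreal_le_1)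
    then have "ennreal (3 powr (- t * of_int (0 - k))) *
        (SUP z\<in>lattice k \<inter> cube 0. ennreal (sqrt (onorm ((*v) (a_star_inv ?a (subcube z k))))))
        \<le> ennreal (3 powr (- t * of_int (0 - k))) * 1"
      by (rule mult_left_mono) simp
    moreover have "3 powr (- t * of_int (0 - k)) = q ^ nat (- k)"
    proof -
      have "q ^ nat (- k) = q powr real (nat (- k))"
        by (simp add: q_def powr_realpow)
      then show ?thesis
        using k by (simp add: q_def powr_powr)
    qed
    ultimately show ?thesis by (simp only: mult_1 mult_1_right)
  qed
  then have "(\<Sum>\<^sub>\<infinity>k\<in>{..0}. ennreal (3 powr (- t * of_int (0 - k))) *
      (SUP z\<in>lattice k \<inter> cube 0. ennreal (sqrt (onorm ((*v) (a_star_inv ?a (subcube z k)))))))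
      \<le> ennreal (1 / (1 - q))"
    using q by (intro infsum_ennreal_geometric_le) simp_all
  then have "X \<le> ennreal (c_s t) * ennreal (1 / (1 - q))"
    unfolding X_def by (rule mult_left_mono) simp
  \<comment> \<open>\<open>c_s t\<close> equals 1 - q and cancels the series, so the bound does not
    depend on t.\<close>
  also have "\<dots> = 1"
    using q by (simp add: c_s_def q_def[symmetric] ennreal_mult[symmetric])
  finally have "X\<^sup>2 \<le> 1"
    by (intro power_le_one) simp_all
  \<comment> \<open>Double inversion is the identity on all of \<open>ennreal\<close>, which also
    covers X = 0.\<close>
  have "Theta_s_t s t 0 K ?a = Lambda_s s 0 K ?a * X\<^sup>2"
    using one_divide_one_divide_ennreal[of "X\<^sup>2"]
    by (simp add: Theta_s_t_def lambda_s_def X_def divide_ennreal_def)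
  also have "\<dots> \<le> Lambda_s s 0 K ?a * 1"
    using \<open>X\<^sup>2 \<le> 1\<close> by (rule mult_left_mono) simp
  finally show ?thesis by simp
qed

section \<open>Total mass and the neighbourhoods of F\<close>

lemma near_F_subset_cube:
  assumes "y \<in> F" "dist x y \<le> \<delta>" "\<delta> < setdist F (frontier (cube 0))"
  shows "x \<in> cube 0"
proof (rule ccontr)
  assume "x \<notin> cube 0"
  \<comment> \<open>A segment that leaves the cube meets its boundary at a point no farther from y
    than x is.\<close>
  then have "closed_segment y x \<inter> frontier (cube 0) \<noteq> {}"
    using assms(1) F_cube by (intro connected_Int_frontier) auto
  then obtain w where w: "w \<in> closed_segment y x" "w \<in> frontier (cube 0)" by blast
  have "setdist F (frontier (cube 0)) \<le> dist y w"
    using assms(1) w(2) by (rule setdist_le_dist)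
  also have "\<dots> \<le> dist y x"
    using segment_bound(1)[OF w(1)] by (simp add: dist_norm norm_minus_commute)
  finally show False
    using assms(2,3) by (simp add: dist_commute)
qed

lemma integral_f_cube:
  assumes "0 < \<delta>" "\<delta> < setdist F (frontier (cube 0))"
  shows "(\<integral>x. f \<delta> x \<partial>lebesgue_on (cube 0)) = 1"
proof -
  have U: "cube 0 \<in> lmeasurable"
    by (intro bounded_open_lmeasurable bounded_cube open_cube)
  have "(\<integral>\<^sup>+x. ennreal (f \<delta> x) \<partial>lebesgue_on (cube 0)) = 1"
    using near_F_subset_cube assms by (intro nn_integral_f_eq_1) (auto simp: open_cube)
  then have "ennreal (\<integral>x. f \<delta> x \<partial>lebesgue_on (cube 0)) = ennreal 1"
    by (simp add: ennreal_integral_f[OF assms(1) U])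
  then show ?thesis
    by (subst (asm) ennreal_inj) (auto intro!: Bochner_Integration.integral_nonneg f_nonneg assms)
qed

lemma setdist_frontier_pos: "0 < setdist F (frontier (cube 0))"
proof -
  have "cube 0 \<noteq> (UNIV :: (real^'n) set)"
    using bounded_cube not_bounded_UNIV by metis
  then have "frontier (cube 0 :: (real^'n) set) \<noteq> {}"
    using F_nonempty F_cube by (auto simp: frontier_eq_empty)
  moreover have "F \<inter> frontier (cube 0) = {}"
    using F_cube by (auto simp: frontier_def interior_open[OF open_cube])
  ultimately show ?thesis
    using F_nonempty compact_F by (simp add: setdist_gt_0_compact_closed)
qed

definition near_F :: "real \<Rightarrow> (real^'n) set" where
  "near_F \<delta> = {x. \<exists>y\<in>F. dist x y \<le> \<delta>}"

lemma closed_near_F: "closed (near_F \<delta>)"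
proof -
  have "near_F \<delta> = {x. infdist x F \<le> \<delta>}"
  proof (intro Set.set_eqI iffI)
    fix x assume "x \<in> near_F \<delta>"
    then show "x \<in> {x. infdist x F \<le> \<delta>}"
      by (auto simp: near_F_def intro: order_trans[OF infdist_le])
  next
    fix x assume x: "x \<in> {x. infdist x F \<le> \<delta>}"
    obtain y where "y \<in> F" "infdist x F = dist x y"
      using infdist_attains_inf[OF compact_imp_closed[OF compact_F] F_nonempty] by blast
    then show "x \<in> near_F \<delta>"
      using x by (auto simp: near_F_def)
  qed
  then show ?thesis
    by (simp add: closed_Collect_le continuous_on_infdist)
qed

lemma bounded_near_F: "bounded (near_F \<delta>)"
proof -
  obtain B where B: "\<And>y. y \<in> F \<Longrightarrow> norm y \<le> B"
    using compact_imp_bounded[OF compact_F] by (auto simp: bounded_iff)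
  have "norm x \<le> B + \<delta>" if x: "x \<in> near_F \<delta>" for x
  proof -
    obtain y where "y \<in> F" "dist x y \<le> \<delta>"
      using x by (auto simp: near_F_def)
    then show ?thesis
      using B[of y] norm_triangle_sub[of x y] by (simp add: dist_norm)
  qed
  then show ?thesis
    by (auto simp: bounded_iff)
qed

text \<open>Both sides are compared with the product measure of the pairs at distance at most \<open>2\<delta>\<close>:
  slices through \<open>x\<close> near \<open>F\<close> have \<open>\<mu>\<close>-mass at least \<open>\<delta>\<^sup>\<alpha> / C\<^sub>0\<close>, slices through \<open>y\<close> are balls.\<close>

lemma measure_near_F_le:
  assumes "0 < \<delta>" "\<delta> < 1"
  shows "measure lebesgue (near_F \<delta>) \<le> C\<^sub>0 * 2 ^ CARD('n) * measure lborel (ball (0 :: real^'n) 1) * \<delta> powr (real CARD('n) - \<alpha>)"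
proof -
  interpret pair_sigma_finite lborel \<mu> ..
  let ?c = "measure lborel (ball (0 :: real^'n) 1)" and ?m = "\<delta> powr \<alpha> / C\<^sub>0"
  have m: "0 < ?m"
    using assms C\<^sub>0 by simp
  have S [measurable]: "near_F \<delta> \<in> sets lborel"
    by (simp add: closed_near_F)
  \<comment> \<open>Tonelli's theorem needs joint measurability of this relation; it is closed, and
    the Borel sets of the product space form the product sigma-algebra.\<close>
  have "closed {z :: (real^'n) \<times> (real^'n). dist (fst z) (snd z) \<le> 2 * \<delta>}"
    by (intro closed_Collect_le continuous_intros)
  then have "indicator {z :: (real^'n) \<times> (real^'n). dist (fst z) (snd z) \<le> 2 * \<delta>} \<in> borel_measurable (borel \<Otimes>\<^sub>M borel)"
    by (intro borel_measurable_indicator) (simp only: borel_prod borel_closed)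
  moreover have "(\<lambda>(x, y). indicator (cball x (2 * \<delta>)) y :: ennreal)
      = indicator {z :: (real^'n) \<times> (real^'n). dist (fst z) (snd z) \<le> 2 * \<delta>}"
    by (auto simp: indicator_def fun_eq_iff)
  ultimately have "(\<lambda>(x, y). indicator (cball x (2 * \<delta>)) y :: ennreal) \<in> borel_measurable (borel \<Otimes>\<^sub>M (borel :: (real^'n) measure))"
    by simp
  then have [measurable]: "(\<lambda>(x, y). indicator (cball x (2 * \<delta>)) y :: ennreal) \<in> borel_measurable (lborel \<Otimes>\<^sub>M \<mu>)"
    using measurable_cong_sets[OF sets_pair_measure_cong[OF sets_lborel[symmetric] sets_\<mu>[symmetric]] refl] by blast
  have ball: "?m \<le> measure \<mu> (cball x (2 * \<delta>))" if x: "x \<in> near_F \<delta>" for x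
  proof -
    obtain y where y: "y \<in> F" "dist x y \<le> \<delta>"
      using x by (auto simp: near_F_def)
    have "?m \<le> measure \<mu> (ball y \<delta>)"
      using ahlfors y(1) assms by (auto simp: ahlfors_regular_def)
    also have "ball y \<delta> \<subseteq> cball x (2 * \<delta>)"
    proof
      fix w assume "w \<in> ball y \<delta>"
      then show "w \<in> cball x (2 * \<delta>)"
        using y(2) dist_triangle[of x w y] by simp
    qed
    then have "measure \<mu> (ball y \<delta>) \<le> measure \<mu> (cball x (2 * \<delta>))"
      by (intro \<mu>.finite_measure_mono) (simp_all add: sets_\<mu>)
    finally show ?thesis .
  qed
  have "ennreal ?m * emeasure lborel (near_F \<delta>) = (\<integral>\<^sup>+x. ennreal ?m * indicator (near_F \<delta>) x \<partial>lborel)"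
    by (rule nn_integral_cmult_indicator[OF S, symmetric])
  also have "\<dots> \<le> (\<integral>\<^sup>+x. emeasure \<mu> (cball x (2 * \<delta>)) \<partial>lborel)"
    using ball by (intro nn_integral_mono) (auto simp: indicator_def \<mu>.emeasure_eq_measure ennreal_leI)
  also have "\<dots> = (\<integral>\<^sup>+x. (\<integral>\<^sup>+y. indicator (cball x (2 * \<delta>)) y \<partial>\<mu>) \<partial>lborel)"
    by (simp add: sets_\<mu>)
  also have "\<dots> = (\<integral>\<^sup>+y. (\<integral>\<^sup>+x. indicator (cball x (2 * \<delta>)) y \<partial>lborel) \<partial>\<mu>)"
    by (rule Fubini'[symmetric]) measurable
  also have "\<dots> = (\<integral>\<^sup>+y. emeasure lborel (cball y (2 * \<delta>)) \<partial>\<mu>)"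
  proof (intro nn_integral_cong)
    fix y
    have "(\<integral>\<^sup>+x. indicator (cball x (2 * \<delta>)) y \<partial>lborel) = (\<integral>\<^sup>+x. indicator (cball y (2 * \<delta>)) x \<partial>lborel)"
      by (intro nn_integral_cong) (simp add: indicator_def dist_commute)
    then show "(\<integral>\<^sup>+x. indicator (cball x (2 * \<delta>)) y \<partial>lborel) = emeasure lborel (cball y (2 * \<delta>))"
      by simp
  qed
  also have "\<dots> = (\<integral>\<^sup>+y. ennreal ((2 * \<delta>) ^ CARD('n) * ?c) \<partial>\<mu>)"
  proof (intro nn_integral_cong)
    fix y :: "real^'n"
    have "emeasure lborel (cball y (2 * \<delta>)) = ennreal (measure lborel (cball y (2 * \<delta>)))"
      using emeasure_lborel_cball_finite[of y "2 * \<delta>"] by (intro emeasure_eq_ennreal_measure) simp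
    then show "emeasure lborel (cball y (2 * \<delta>)) = ennreal ((2 * \<delta>) ^ CARD('n) * ?c)"
      using assms(1) by (simp add: content_cball_conv_ball content_ball_conv_unit_ball[of "2 * \<delta>" y])
  qed
  also have "\<dots> = ennreal ((2 * \<delta>) ^ CARD('n) * ?c)"
    by (simp add: \<mu>.emeasure_space_1[unfolded space_\<mu>])
  finally have "ennreal ?m * emeasure lborel (near_F \<delta>) \<le> ennreal ((2 * \<delta>) ^ CARD('n) * ?c)" .
  moreover have "emeasure lborel (near_F \<delta>) = ennreal (measure lborel (near_F \<delta>))"
    using emeasure_bounded_finite[OF bounded_near_F[of \<delta>]] by (intro emeasure_eq_ennreal_measure) simp
  ultimately have "?m * measure lborel (near_F \<delta>) \<le> (2 * \<delta>) ^ CARD('n) * ?c"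
    using m assms(1) by (simp flip: ennreal_mult)
  then have "measure lborel (near_F \<delta>) \<le> (2 * \<delta>) ^ CARD('n) * ?c / ?m"
    by (intro mult_imp_le_div_pos[OF m]) (simp only: mult.commute)
  also have "\<dots> = C\<^sub>0 * 2 ^ CARD('n) * ?c * \<delta> powr (real CARD('n) - \<alpha>)"
    using assms(1) C\<^sub>0 by (simp add: powr_diff powr_realpow power_mult_distrib)
  finally show ?thesis
    using S by (simp add: measure_completion)
qed

section \<open>Divergence of the L^p norms\<close>

lemma integrable_powr:
  assumes "0 < \<delta>" "0 \<le> c" "0 \<le> p" "U \<in> lmeasurable"
  shows "integrable (lebesgue_on U) (\<lambda>x. \<bar>c + f \<delta> x\<bar> powr p)"
proof (rule finite_measure.integrable_const_bound[OF finite_measure_lebesgue_on[OF assms(4)]])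
  show "AE x in lebesgue_on U. norm (\<bar>c + f \<delta> x\<bar> powr p) \<le> (c + eta_bound / \<delta> ^ CARD('n)) powr p"
    using assms f_nonneg[OF assms(1)] f_le_const[OF assms(1)] by (intro AE_I2) (simp add: powr_mono2)
qed measurable

text \<open>Mass 1 is squeezed into a set of vanishing volume. Once M times this volume is below
  1/2, subtracting M on the set leaves an integral of at least 1/2, and M^(p-1) times the difference
  is at most the p-th power.\<close>

lemma Lp_norm_f_at_top:
  assumes "1 < p" "\<alpha> < real CARD('n)"
  shows "filterlim (\<lambda>\<delta>. Lp_norm p (cube 0) (f \<delta>)) at_top (at_right 0)"
  unfolding filterlim_at_top
proof
  fix Z :: real
  \<comment> \<open>A positive target, so that the p-th root of Y^p is Y also when Z is
    negative.\<close>
  define Y where "Y = max Z 1"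
  \<comment> \<open>Chosen so that half of M^(p-1) is Y^p; the half is the mass that survives the
    subtraction.\<close>
  define M where "M = (2 * Y powr p) powr (1 / (p - 1))"
  have M: "0 < M" "M powr (p - 1) = 2 * Y powr p"
    using assms(1) by (simp_all add: M_def Y_def powr_powr)
  define c where "c = C\<^sub>0 * 2 ^ CARD('n) * measure lborel (ball (0 :: real^'n) 1)"
  have "((\<lambda>\<delta>. M * (c * \<delta> powr (real CARD('n) - \<alpha>))) \<longlongrightarrow> M * (c * 0)) (at_right 0)"
  proof (intro tendsto_mult tendsto_const)
    have "((\<lambda>\<delta>::real. \<delta> powr (real CARD('n) - \<alpha>)) \<longlongrightarrow> 0 powr (real CARD('n) - \<alpha>)) (at_right 0)"
      using assms(2)
      by (intro tendsto_powr' tendsto_ident_at tendsto_const) (auto simp: eventually_at_filter)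
    then show "((\<lambda>\<delta>::real. \<delta> powr (real CARD('n) - \<alpha>)) \<longlongrightarrow> 0) (at_right 0)"
      by simp
  qed
  then have "\<forall>\<^sub>F \<delta> in at_right 0. M * (c * \<delta> powr (real CARD('n) - \<alpha>)) < 1 / 2"
    by (rule order_tendstoD) simp
  moreover have "\<forall>\<^sub>F \<delta> in at_right 0. \<delta> \<in> {0<..<min 1 (setdist F (frontier (cube 0)))}"
    using setdist_frontier_pos by (intro eventually_at_right_real) simp
  ultimately show "\<forall>\<^sub>F \<delta> in at_right 0. Z \<le> Lp_norm p (cube 0) (f \<delta>)"
  proof eventually_elim
    case (elim \<delta>)
    then have \<delta>: "0 < \<delta>" "\<delta> < 1" "\<delta> < setdist F (frontier (cube 0))" by auto
    let ?L = "lebesgue_on (cube 0 :: (real^'n) set)"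
    have U: "cube 0 \<in> (lmeasurable :: (real^'n) set set)"
      by (intro bounded_open_lmeasurable bounded_cube open_cube)
    have S: "near_F \<delta> \<subseteq> cube 0"
      using near_F_subset_cube \<delta>(3) by (auto simp: near_F_def)
    have Sm: "near_F \<delta> \<in> sets lebesgue"
      by (simp add: closed_near_F)
    have SL: "near_F \<delta> \<in> sets ?L"
      using S Sm U by (simp add: sets_restrict_space_iff fmeasurableD)
    have mS: "measure ?L (near_F \<delta> \<inter> cube 0) = measure lebesgue (near_F \<delta>)"
      using S U by (simp add: Int_absorb2 measure_restrict_space fmeasurableD)
    have indS: "integrable ?L (indicat_real (near_F \<delta>))"
      using SL finite_measure.emeasure_finite[OF finite_measure_lebesgue_on[OF U], of "near_F \<delta>"]
      by (intro integrable_real_indicator) (simp_all add: top.not_eq_extremum)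
    \<comment> \<open>A Chebyshev-type substitute for Hoelder's inequality.\<close>
    have pointwise: "M powr (p - 1) * (f \<delta> x - M * indicat_real (near_F \<delta>) x) \<le> \<bar>f \<delta> x\<bar> powr p" for x
    proof (cases "x \<in> near_F \<delta> \<and> M \<le> f \<delta> x")
      case True
      then have "M powr (p - 1) * f \<delta> x \<le> f \<delta> x powr (p - 1) * f \<delta> x"
        using M(1) assms(1) by (intro mult_right_mono powr_mono2) auto
      also have "\<dots> = f \<delta> x powr p"
        using True M(1) powr_add[of "f \<delta> x" "p - 1" 1] by simp
      finally have "M powr (p - 1) * f \<delta> x \<le> f \<delta> x powr p" .
      moreover have "0 \<le> M powr (p - 1) * M"
        using M(1) by simp
      ultimately have "M powr (p - 1) * (f \<delta> x - M) \<le> f \<delta> x powr p"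
        unfolding right_diff_distrib by linarith
      then show ?thesis
        using True f_nonneg[OF \<delta>(1), of x] by simp
    next
      case False
      have "f \<delta> x - M * indicat_real (near_F \<delta>) x \<le> 0"
      proof (cases "x \<in> near_F \<delta>")
        case False
        then have "f \<delta> x = 0"
          using \<delta>(1) by (intro f_eq_0) (auto simp: near_F_def not_le)
        then show ?thesis
          using False by simp
      qed (use \<open>\<not> (x \<in> near_F \<delta> \<and> M \<le> f \<delta> x)\<close> in simp)
      then have "M powr (p - 1) * (f \<delta> x - M * indicat_real (near_F \<delta>) x) \<le> 0"
        by (simp add: mult_nonneg_nonpos)
      then show ?thesis
        by (rule order_trans) simp
    qed
    have "M * measure lebesgue (near_F \<delta>) \<le> M * (c * \<delta> powr (real CARD('n) - \<alpha>))"
      using measure_near_F_le[OF \<delta>(1,2)] M(1) by (intro mult_left_mono) (simp_all add: c_def)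
    then have "1 / 2 \<le> 1 - M * measure lebesgue (near_F \<delta>)"
      using elim(1) by linarith
    then have "Y powr p \<le> M powr (p - 1) * (1 - M * measure lebesgue (near_F \<delta>))"
      unfolding M(2) using mult_left_mono[of "1/2" "1 - M * measure lebesgue (near_F \<delta>)" "2 * Y powr p"] by simp
    also have "\<dots> = (\<integral>x. M powr (p - 1) * (f \<delta> x - M * indicat_real (near_F \<delta>) x) \<partial>?L)"
      using integrable_f[OF \<delta>(1) U] indS SL mS integral_f_cube[OF \<delta>(1,3)] by simp
    also have "\<dots> \<le> (\<integral>x. \<bar>f \<delta> x\<bar> powr p \<partial>?L)"
      using integrable_powr[OF \<delta>(1), of 0 p "cube 0"] integrable_f[OF \<delta>(1) U] indS U assms(1) pointwise
      by (intro integral_mono) simp_all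
    finally have "(Y powr p) powr (1 / p) \<le> Lp_norm p (cube 0) (f \<delta>)"
      unfolding Lp_norm_def using assms(1) by (intro powr_mono2) simp_all
    then show "Z \<le> Lp_norm p (cube 0) (f \<delta>)"
      using assms(1) by (simp add: powr_powr Y_def)
  qed
qed

lemma Lp_norm_a_delta_at_top:
  assumes "1 < p" "\<alpha> < real CARD('n)"
  shows "filterlim (\<lambda>\<delta>. Lp_norm p (cube 0) (a_delta \<eta> \<mu> \<delta>)) at_top (at_right 0)"
proof (rule filterlim_at_top_mono[OF Lp_norm_f_at_top[OF assms]])
  show "\<forall>\<^sub>F \<delta> in at_right 0. Lp_norm p (cube 0) (f \<delta>) \<le> Lp_norm p (cube 0) (a_delta \<eta> \<mu> \<delta>)"
  proof (rule eventually_mono[OF eventually_at_right_less])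
    fix \<delta> :: real assume \<delta>: "0 < \<delta>"
    have U: "cube 0 \<in> (lmeasurable :: (real^'n) set set)"
      by (intro bounded_open_lmeasurable bounded_cube open_cube)
    have le: "\<bar>f \<delta> x\<bar> powr p \<le> \<bar>1 + f \<delta> x\<bar> powr p" for x
      using f_nonneg[OF \<delta>] assms(1) by (intro powr_mono2) simp_all
    have "(\<integral>x. \<bar>f \<delta> x\<bar> powr p \<partial>lebesgue_on (cube 0)) \<le> (\<integral>x. \<bar>1 + f \<delta> x\<bar> powr p \<partial>lebesgue_on (cube 0))"
      using integrable_powr[OF \<delta>, of 0 p "cube 0"] integrable_powr[OF \<delta>, of 1 p "cube 0"] U assms(1) le
      by (intro integral_mono) simp_all
    moreover have "0 \<le> (\<integral>x. \<bar>f \<delta> x\<bar> powr p \<partial>lebesgue_on (cube 0))"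
      by (intro Bochner_Integration.integral_nonneg) simp
    ultimately show "Lp_norm p (cube 0) (f \<delta>) \<le> Lp_norm p (cube 0) (a_delta \<eta> \<mu> \<delta>)"
      unfolding Lp_norm_def a_delta_def using assms(1) by (intro powr_mono2) simp_all
  qed
qed

end

theorem proposition6p2:
  fixes \<alpha> C\<^sub>0 :: real and \<eta> :: "real^'n \<Rightarrow> real"
  assumes "2 \<le> CARD('n)"
    and "real CARD('n) - 2 < \<alpha>" "\<alpha> < real CARD('n)"
    and "1 \<le> C\<^sub>0"
    and "mollifier \<eta>"
  shows
    "(\<forall>F \<mu>. compact F \<and> F \<subseteq> cube 0 \<and> ahlfors_regular \<alpha> C\<^sub>0 F \<mu> \<longrightarrow>
        (\<forall>\<delta>. 0 < \<delta> \<and> \<delta> < min 1 (setdist F (frontier (cube 0))) / (4 * real CARD('n)) \<longrightarrow>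
           integrable (lebesgue_on (cube 0)) (a_delta \<eta> \<mu> \<delta>) \<and>
           (\<integral>x. a_delta \<eta> \<mu> \<delta> x \<partial>lebesgue_on (cube 0)) = 1 + measure \<mu> (cube 0) \<and>
           1 + measure \<mu> (cube 0) = 2) \<and>
        (\<forall>p>1. filterlim (\<lambda>\<delta>. Lp_norm p (cube 0) (mollified_measure \<eta> \<mu> \<delta>)) at_top (at_right 0)))
     \<and>
     (\<forall>s. 0 < s \<and> s < 1 \<and> real CARD('n) - \<alpha> < 2 * s \<longrightarrow>
        (\<exists>C::real. \<forall>F \<mu> K. compact F \<and> F \<subseteq> cube 0 \<and> ahlfors_regular \<alpha> C\<^sub>0 F \<mu> \<and> admissible_cone K \<longrightarrow>
           (SUP \<delta>\<in>{0<..<1}. Lambda_s s 0 K (\<lambda>x. mat (a_delta \<eta> \<mu> \<delta> x))) \<le> ennreal C))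
     \<and>
     (\<forall>F \<mu>. compact F \<and> F \<subseteq> cube 0 \<and> ahlfors_regular \<alpha> C\<^sub>0 F \<mu> \<longrightarrow>
        (\<forall>s. (real CARD('n) - \<alpha>) / 2 < s \<and> s < 1 \<longrightarrow>
           uniformly_cg_elliptic s {0<..<1} (\<lambda>\<delta> x. mat (a_delta \<eta> \<mu> \<delta> x))) \<and>
        (\<forall>p>1. filterlim (\<lambda>\<delta>. Lp_norm p (cube 0) (a_delta \<eta> \<mu> \<delta>)) at_top (at_right 0)))"
proof (intro conjI allI impI)
  \<comment> \<open>The positivity of \<open>\<alpha>\<close> required by the locale comes from d >=
    2 and \<alpha> > d - 2.\<close>
  have loc: "ahlfors_mollification \<alpha> C\<^sub>0 \<eta> F \<mu>"
    if "compact F \<and> F \<subseteq> cube 0 \<and> ahlfors_regular \<alpha> C\<^sub>0 F \<mu>" for F \<mu>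
    using that assms by unfold_locales auto
  {
    fix F :: "(real^'n) set" and \<mu> \<delta>
    assume H: "compact F \<and> F \<subseteq> cube 0 \<and> ahlfors_regular \<alpha> C\<^sub>0 F \<mu>"
      and \<delta>: "0 < \<delta> \<and> \<delta> < min 1 (setdist F (frontier (cube 0))) / (4 * real CARD('n))"
    interpret ahlfors_mollification \<alpha> C\<^sub>0 \<eta> F \<mu>
      by (rule loc[OF H])
    have U: "cube 0 \<in> (lmeasurable :: (real^'n) set set)"
      by (intro bounded_open_lmeasurable bounded_cube open_cube)
    have "min 1 (setdist F (frontier (cube 0))) / (4 * real CARD('n)) \<le> min 1 (setdist F (frontier (cube 0))) / 1"
      using assms(1) setdist_frontier_pos by (intro divide_left_mono) simp_all
    then have \<delta>': "0 < \<delta>" "\<delta> < setdist F (frontier (cube 0))"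
      using \<delta> by simp_all
    show "integrable (lebesgue_on (cube 0)) (a_delta \<eta> \<mu> \<delta>)"
      by (rule integral_a_delta(1)[OF \<delta>'(1) U])
    show "(\<integral>x. a_delta \<eta> \<mu> \<delta> x \<partial>lebesgue_on (cube 0)) = 1 + measure \<mu> (cube 0)"
      using integral_a_delta(2)[OF \<delta>'(1) U] integral_f_cube[OF \<delta>'] measure_cube[of 0]
      by (simp add: measure_cube_0)
    show "1 + measure \<mu> (cube 0) = 2"
      by (simp add: measure_cube_0)
  }
  {
    fix F :: "(real^'n) set" and \<mu> and p :: real
    assume H: "compact F \<and> F \<subseteq> cube 0 \<and> ahlfors_regular \<alpha> C\<^sub>0 F \<mu>" and p: "1 < p"
    interpret ahlfors_mollification \<alpha> C\<^sub>0 \<eta> F \<mu>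
      by (rule loc[OF H])
    show "filterlim (\<lambda>\<delta>. Lp_norm p (cube 0) (mollified_measure \<eta> \<mu> \<delta>)) at_top (at_right 0)"
      using p assms(3) by (rule Lp_norm_f_at_top)
    show "filterlim (\<lambda>\<delta>. Lp_norm p (cube 0) (a_delta \<eta> \<mu> \<delta>)) at_top (at_right 0)"
      using p assms(3) by (rule Lp_norm_a_delta_at_top)
  }
  {
    fix s :: real
    assume s: "0 < s \<and> s < 1 \<and> real CARD('n) - \<alpha> < 2 * s"
    show "\<exists>C::real. \<forall>F \<mu> K. compact F \<and> F \<subseteq> cube 0 \<and> ahlfors_regular \<alpha> C\<^sub>0 F \<mu> \<and> admissible_cone K \<longrightarrow>
        (SUP \<delta>\<in>{0<..<1}. Lambda_s s 0 K (\<lambda>x. mat (a_delta \<eta> \<mu> \<delta> x))) \<le> ennreal C"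
    proof (intro exI allI impI)
      fix F :: "(real^'n) set" and \<mu> and K :: "'n cone"
      assume H: "compact F \<and> F \<subseteq> cube 0 \<and> ahlfors_regular \<alpha> C\<^sub>0 F \<mu> \<and> admissible_cone K"
      interpret ahlfors_mollification \<alpha> C\<^sub>0 \<eta> F \<mu>
        using H by (intro loc) blast
      \<comment> \<open>The witness is the constant exported from the locale. Its arguments contain
        neither F nor the measure nor K, which is the uniformity claimed.\<close>
      show "(SUP \<delta>\<in>{0<..<1}. Lambda_s s 0 K (\<lambda>x. mat (a_delta \<eta> \<mu> \<delta> x)))
          \<le> ennreal (ahlfors_mollification.Lambda_const \<alpha> C\<^sub>0 \<eta> s)"
        using s assms(3) by (intro SUP_least Lambda_s_le) simp_all
    qed
  }
  {
    fix F :: "(real^'n) set" and \<mu> and s :: real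
    assume H: "compact F \<and> F \<subseteq> cube 0 \<and> ahlfors_regular \<alpha> C\<^sub>0 F \<mu>"
      and s: "(real CARD('n) - \<alpha>) / 2 < s \<and> s < 1"
    interpret ahlfors_mollification \<alpha> C\<^sub>0 \<eta> F \<mu>
      by (rule loc[OF H])
    have s': "real CARD('n) - \<alpha> < 2 * s" "0 < s"
    proof -
      show "real CARD('n) - \<alpha> < 2 * s"
        using s by simp
      then show "0 < s"
        using assms(3) by simp
    qed
    show "uniformly_cg_elliptic s {0<..<1} (\<lambda>\<delta> x. mat (a_delta \<eta> \<mu> \<delta> x))"
      unfolding uniformly_cg_elliptic_def
    proof (intro exI ballI)
      fix t \<delta> :: real assume "t \<in> {0<..<1 - s}" "\<delta> \<in> {0<..<1}"
      then have "0 < t" "0 < \<delta>" by simp_all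
      then show "Theta_s_t s t 0 (cone_Un {K_pow, K_trunc}) (\<lambda>x. mat (a_delta \<eta> \<mu> \<delta> x)) \<le> ennreal (Lambda_const s)"
        using s' assms(3) by (intro order_trans[OF Theta_s_t_le_Lambda_s Lambda_s_le])
    qed
  }
qed

end
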